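(* The following evaluations hold: $$h'_{2,1}=2^{-1/8}(\sqrt2-1)^{1/8},$$ $$h'_{2,3}= 2^{-1/8} (-17-12\sqrt2+10\sqrt3+7\sqrt6)^{1/8},$$ $$h'_{2,5}=2^{-1/8}(-161-72\sqrt5+51\sqrt{10} +114\sqrt2)^{1/8},$$ $$h'_{2,6}=(85\sqrt6+147\sqrt2-208-120\sqrt3)^{1/8},$$ $$h'_{2,9}=2^{-1/8}(2772\sqrt3-4801+3395\sqrt2-1960\sqrt6)^{1/8}.$$
   Context: For $|q|<1$, $\varphi(q)=\sum_{m=-\infty}^{\infty}q^{m^2}$. For positive real $k,n$ define $$h'_{k,n}=\frac{\varphi(-q)}{k^{1/4}\varphi(-q^k)},\qquad q=e^{-2\pi\sqrt{n/k}}.$$ *)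

theory Defs
  imports "HOL-Analysis.Analysis"
begin

text \<open>Ramanujan's theta function; the series converges absolutely exactly for \<open>norm q < 1\<close>,
  the only range where the value is meaningful. The exponent \<open>m\<^sup>2\<close> is a nonnegative integer, so
  \<open>nat\<close> loses nothing and negative \<open>q\<close> is allowed.\<close>

definition phi :: "'a :: {real_normed_field, banach} \<Rightarrow> 'a" where
  "phi q = (\<Sum>\<^sub>\<infinity> m :: int. q ^ nat (m\<^sup>2))"

text \<open>Intended for real parameters \<open>k > 0\<close> and \<open>n > 0\<close>. Here \<open>0 < q < 1\<close>, so \<open>q powr k\<close> is the
  usual real power; the minus sign in front of it is outside the power.\<close>

definition h' :: "real \<Rightarrow> real \<Rightarrow> real" where
  "h' k n = (let q = exp (- 2 * pi * sqrt (n / k))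
             in phi (- q) / (k powr (1/4) * phi (- (q powr k))))"

end

theory Submission
  imports Defs "HOL-Probability.Characteristic_Functions" "HOL-Real_Asymp.Real_Asymp"
begin

text \<open>With \<open>q = exp (- s)\<close> and \<open>s = \<pi> \<surd>(2n)\<close>, the duplication formula for theta constants turns
  \<open>h' 2 n ^ 8\<close> into \<open>(1 - k\<^sup>2) / 4\<close> for the singular modulus \<open>k = \<theta>\<^sub>2\<^sup>2 / \<theta>\<^sub>3\<^sup>2\<close> at \<open>q\<close>, so the moduli
  \<open>k\<^sub>2, k\<^sub>6, k\<^sub>1\<^sub>0, k\<^sub>1\<^sub>2, k\<^sub>1\<^sub>8\<close> have to be found. Inversion \<open>s \<mapsto> \<pi>\<^sup>2 / s\<close> (Poisson summation) exchanges \<open>k\<close> and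
  its complement, and comparing it with Landen's transformation and with a modular equation of
  degree 3 or 5 gives an algebraic equation for \<open>k\<close>. The modular equations come from rearranging
  double series along sublattices: \<open>m\<^sup>2 + 3 n\<^sup>2\<close> for degree 3, and multiplication by \<open>2 + i\<close> on the
  Gaussian integers for degree 5. Wrong roots are excluded because \<open>k\<close> decreases in \<open>s\<close>.\<close>

section \<open>Theta series\<close>

text \<open>Each series carries a sign \<open>e\<close> = +-1 and a real shift \<open>a\<close>,
  because a rearrangement along a sublattice turns theta constants into theta values at fractional
  shifts; the fifths and tenths of degree 5 are such shifts. Degree 5 is the hard case. Rearranging
  leaves two unknown products, one at fifths and one at tenths. Neither is expressed by theta
  constants, but the product of the two is. The resulting equation mixes \<open>theta4\<close> at s
  with \<open>theta2\<close> at s / 2, and this mixture closes up at s = 2 pi / sqrt 10, where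
  inversion identifies its four values in two pairs. The numbers under the roots come from closed
  chains: inversion sends pi sqrt m to pi / sqrt m, and multiplications by 2, 3 or 5 with product m
  lead back. This serves m = 2, 6 and 10, as well as m = 3; 12 is then reached from 3 by one more
  doubling, and 18 from 2 by one tripling.\<close>

definition theta :: "real \<Rightarrow> real \<Rightarrow> real \<Rightarrow> real" where
  "theta e s a = (\<Sum>\<^sub>\<infinity>n::int. e powi n * exp (- s * (of_int n + a)\<^sup>2))"

section \<open>Summability, products and symmetries of the theta series\<close>

lemma has_sum_times_real:
  fixes f :: "'a \<Rightarrow> real" and g :: "'b \<Rightarrow> real"
  assumes f: "(f has_sum x) A" and g: "(g has_sum y) B"
  shows "((\<lambda>(a, b). f a * g b) has_sum (x * y)) (A \<times> B)"
proof (rule has_sum_SigmaI)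
  show "((\<lambda>b. case (a, b) of (a, b) \<Rightarrow> f a * g b) has_sum f a * y) B" for a
    using has_sum_cmult_right[OF g] by simp
  show "((\<lambda>a. f a * y) has_sum x * y) A"
    by (rule has_sum_cmult_left[OF f])
  \<comment> \<open>Unconditional summability of reals is absolute, so the product family is
    summable too. This licenses every later regrouping of a double series.\<close>
  have "(\<lambda>a. \<bar>f a\<bar>) summable_on A" "(\<lambda>b. \<bar>g b\<bar>) summable_on B"
    using summable_on_iff_abs_summable_on_real[of f A] summable_on_iff_abs_summable_on_real[of g B]
      has_sum_imp_summable[OF f] has_sum_imp_summable[OF g] by simp_all
  then obtain X Y where X: "((\<lambda>a. \<bar>f a\<bar>) has_sum X) A" and Y: "((\<lambda>b. \<bar>g b\<bar>) has_sum Y) B"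
    by (meson has_sum_infsum)
  have "(\<lambda>(a, b). \<bar>f a\<bar> * \<bar>g b\<bar>) summable_on A \<times> B"
  proof (rule summable_on_SigmaI)
    show "((\<lambda>b. case (a, b) of (a, b) \<Rightarrow> \<bar>f a\<bar> * \<bar>g b\<bar>) has_sum \<bar>f a\<bar> * Y) B" for a
      using has_sum_cmult_right[OF Y] by simp
    show "(\<lambda>a. \<bar>f a\<bar> * Y) summable_on A"
      using has_sum_cmult_left[OF X] has_sum_imp_summable by blast
  qed auto
  then show "(\<lambda>(a, b). f a * g b) summable_on A \<times> B"
    by (subst summable_on_iff_abs_summable_on_real) (simp add: case_prod_unfold abs_mult)
qed

lemma summable_on_power_abs_int:
  fixes r :: real
  assumes "0 \<le> r" "r < 1"
  shows "(\<lambda>n::int. r ^ nat \<bar>n\<bar>) summable_on UNIV"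
proof -
  have geo: "(\<lambda>n::nat. r ^ n) summable_on UNIV"
    using assms by (intro summable_nonneg_imp_summable_on summable_geometric) auto
  have "(\<lambda>n::int. r ^ nat \<bar>n\<bar>) summable_on range int"
    by (subst summable_on_reindex) (use geo in \<open>auto simp: o_def\<close>)
  moreover have "(\<lambda>n::int. r ^ nat \<bar>n\<bar>) summable_on range (\<lambda>n. - int n)"
    by (subst summable_on_reindex) (use geo in \<open>auto simp: o_def inj_on_def\<close>)
  ultimately have "(\<lambda>n::int. r ^ nat \<bar>n\<bar>) summable_on (range int \<union> range (\<lambda>n. - int n))"
    by (rule summable_on_union)
  moreover have "range int \<union> range (\<lambda>n. - int n) = UNIV"
    by (metis (no_types, lifting) UNIV_I UNIV_eq_I UnI1 UnI2 int_cases2 range_eqI)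
  ultimately show ?thesis by simp
qed

lemma summable_on_gauss:
  fixes s a :: real
  assumes s: "s > 0"
  shows "(\<lambda>n::int. exp (- s * (of_int n + a)\<^sup>2)) summable_on UNIV"
proof (rule summable_on_comparison_test)
  show "(\<lambda>n::int. exp (s * (2 * \<bar>a\<bar> + 1)) * exp (- 2 * s) ^ nat \<bar>n\<bar>) summable_on UNIV"
    by (intro summable_on_cmult_right summable_on_power_abs_int) (use s in auto)
  fix n :: int
  \<comment> \<open>The tangent bound z^2 \<ge> 2 z - 1 at z = |n + a| replaces the Gaussian by a
    geometric series in |n|.\<close>
  have "(\<bar>of_int n + a\<bar> - 1)\<^sup>2 \<ge> 0" by simp
  then have "(of_int n + a)\<^sup>2 \<ge> 2 * \<bar>of_int n + a\<bar> - 1"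
    by (simp add: power2_eq_square algebra_simps abs_if split: if_splits)
  moreover have "\<bar>of_int n\<bar> \<le> \<bar>of_int n + a\<bar> + \<bar>a\<bar>" by (simp add: abs_if)
  ultimately have "2 * \<bar>of_int n\<bar> - 2 * \<bar>a\<bar> - 1 \<le> (of_int n + a)\<^sup>2" by argo
  then have "s * (2 * \<bar>of_int n\<bar> - 2 * \<bar>a\<bar> - 1) \<le> s * (of_int n + a)\<^sup>2"
    using s by simp
  then have "exp (- s * (of_int n + a)\<^sup>2) \<le> exp (s * (2 * \<bar>a\<bar> + 1) + \<bar>of_int n\<bar> * (- 2 * s))"
    by (simp add: algebra_simps)
  also have "\<dots> = exp (s * (2 * \<bar>a\<bar> + 1)) * exp (- 2 * s) ^ nat \<bar>n\<bar>"
    by (subst exp_add) (simp flip: exp_of_nat_mult)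
  finally show "exp (- s * (of_int n + a)\<^sup>2) \<le> exp (s * (2 * \<bar>a\<bar> + 1)) * exp (- 2 * s) ^ nat \<bar>n\<bar>" .
qed simp

lemma has_sum_theta:
  assumes "s > 0" "\<bar>e\<bar> = 1"
  shows "((\<lambda>n::int. e powi n * exp (- s * (of_int n + a)\<^sup>2)) has_sum theta e s a) UNIV"
  unfolding theta_def
proof (rule has_sum_infsum)
  show "(\<lambda>n::int. e powi n * exp (- s * (of_int n + a)\<^sup>2)) summable_on UNIV"
    using summable_on_gauss[OF assms(1), of a] assms(2)
    by (subst summable_on_iff_abs_summable_on_real) (simp add: abs_mult power_int_abs)
qed

lemma theta_eqI:
  assumes "s > 0" "\<bar>e\<bar> = 1"
    and "((\<lambda>n::int. e powi n * exp (- s * (of_int n + a)\<^sup>2)) has_sum x) UNIV"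
  shows "theta e s a = x"
  using has_sum_theta[OF assms(1,2)] assms(3) has_sum_unique by blast

lemma sign_powi_mult_self:
  fixes e :: real
  assumes "\<bar>e\<bar> = 1"
  shows "e powi n * e powi n = 1"
  using assms by (metis abs_mult_self_eq abs_1 mult_1 power_int_abs power_int_1_left)

lemma sign_powi_uminus:
  fixes e :: real
  assumes "\<bar>e\<bar> = 1"
  shows "e powi (- n) = e powi n"
  using sign_powi_mult_self[OF assms, of n]
  by (metis power_int_minus inverse_unique)

lemma theta_shift:
  assumes "s > 0" "\<bar>e\<bar> = 1"
  shows "theta e s (a + 1) = e * theta e s a"
proof (rule theta_eqI[OF assms])
  have "bij_betw (\<lambda>n::int. n + 1) UNIV UNIV"
    by (rule bij_betw_byWitness[where f' = "\<lambda>n. n - 1"]) auto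
  from has_sum_cmult_right[OF iffD2[OF has_sum_reindex_bij_betw[OF this] has_sum_theta[OF assms, of a]], of e]
  have "((\<lambda>n::int. e * (e powi (n + 1) * exp (- s * (of_int (n + 1) + a)\<^sup>2))) has_sum e * theta e s a) UNIV" .
  moreover have "e * (e powi (n + 1) * exp (- s * (of_int (n + 1) + a)\<^sup>2)) =
      e powi n * exp (- s * (of_int n + (a + 1))\<^sup>2)" for n :: int
  proof -
    have "e * e = 1" using sign_powi_mult_self[OF assms(2), of 1] by simp
    moreover have "e powi (n + 1) = e powi n * e"
      using assms(2) by (subst power_int_add) auto
    ultimately have "e * e powi (n + 1) = e powi n" by simp
    then show ?thesis by (simp add: add_ac flip: mult.assoc)
  qed
  ultimately show "((\<lambda>n::int. e powi n * exp (- s * (of_int n + (a + 1))\<^sup>2)) has_sum e * theta e s a) UNIV"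
    by simp
qed

lemma theta_uminus:
  assumes "s > 0" "\<bar>e\<bar> = 1"
  shows "theta e s (- a) = theta e s a"
proof (rule theta_eqI[OF assms])
  have "bij_betw (\<lambda>n::int. - n) UNIV UNIV"
    by (rule bij_betw_byWitness[where f' = "\<lambda>n. - n"]) auto
  from iffD2[OF has_sum_reindex_bij_betw[OF this] has_sum_theta[OF assms, of a]]
  have "((\<lambda>n::int. e powi (- n) * exp (- s * (of_int (- n) + a)\<^sup>2)) has_sum theta e s a) UNIV" .
  moreover have "(of_int (- n) + a)\<^sup>2 = (of_int n + - a)\<^sup>2" for n :: int
    by (simp add: power2_eq_square algebra_simps)
  ultimately show "((\<lambda>n::int. e powi n * exp (- s * (of_int n + - a)\<^sup>2)) has_sum theta e s a) UNIV"
    by (simp only: sign_powi_uminus[OF assms(2)])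
qed

lemma has_sum_theta_times:
  assumes "s > 0" "\<bar>e\<bar> = 1" "s' > 0" "\<bar>d\<bar> = 1"
  shows "((\<lambda>(m::int, n::int). e powi m * d powi n *
      exp (- (s * (of_int m + a)\<^sup>2 + s' * (of_int n + b)\<^sup>2))) has_sum theta e s a * theta d s' b) UNIV"
  using has_sum_times_real[OF has_sum_theta[OF assms(1,2), of a] has_sum_theta[OF assms(3,4), of b]]
  by (simp add: case_prod_unfold algebra_simps flip: exp_add)

section \<open>Rearrangement of theta series along sublattices\<close>

lemma theta_split:
  assumes "s > 0"
  shows "theta 1 s a = theta 1 (4 * s) (a / 2) + theta 1 (4 * s) ((a + 1) / 2)"
proof (rule theta_eqI)
  let ?f = "\<lambda>n::int. 1 powi n * exp (- s * (of_int n + a)\<^sup>2)"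
  have s4: "4 * s > 0" using assms by simp
  have ev: "bij_betw (\<lambda>n::int. 2 * n) UNIV {n. even n}"
    by (rule bij_betw_byWitness[where f' = "\<lambda>n. n div 2"]) auto
  have od: "bij_betw (\<lambda>n::int. 2 * n + 1) UNIV {n. odd n}"
    by (rule bij_betw_byWitness[where f' = "\<lambda>n. n div 2"]) auto
  have "(?f has_sum theta 1 (4 * s) (a / 2)) {n. even n}"
    by (subst has_sum_reindex_bij_betw[OF ev, symmetric])
       (use has_sum_theta[OF s4, of 1 "a/2"] in \<open>simp add: power2_eq_square algebra_simps\<close>)
  moreover have "(?f has_sum theta 1 (4 * s) ((a + 1) / 2)) {n. odd n}"
    by (subst has_sum_reindex_bij_betw[OF od, symmetric])
       (use has_sum_theta[OF s4, of 1 "(a+1)/2"] in \<open>simp add: power2_eq_square algebra_simps add_divide_distrib\<close>)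
  ultimately have "(?f has_sum theta 1 (4 * s) (a / 2) + theta 1 (4 * s) ((a + 1) / 2))
      ({n. even n} \<union> {n. odd n})"
    by (rule has_sum_Un_disjoint) auto
  moreover have "{n. even n} \<union> {n. odd n} = (UNIV :: int set)" by auto
  ultimately show "(?f has_sum theta 1 (4 * s) (a / 2) + theta 1 (4 * s) ((a + 1) / 2)) UNIV" by simp
qed (use assms in auto)

text \<open>The two products are the sums over the two cosets of \<open>1 + i\<close> in the Gaussian integers.\<close>

lemma theta_rotate_45:
  assumes s: "s > 0" and e: "\<bar>e\<bar> = 1" and d: "\<bar>d\<bar> = 1"
  shows "theta e s a * theta d s b =
      theta (e * d) (2 * s) ((a + b) / 2) * theta (e * d) (2 * s) ((a - b) / 2)
      + e * (theta (e * d) (2 * s) ((a + b + 1) / 2) * theta (e * d) (2 * s) ((a - b + 1) / 2))"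
    (is "_ = ?X + e * ?Y")
proof -
  let ?f = "\<lambda>(m::int, n::int). e powi m * d powi n *
      exp (- (s * (of_int m + a)\<^sup>2 + s * (of_int n + b)\<^sup>2))"
  let ?E = "{(m, n). even (m + n)} :: (int \<times> int) set"
  let ?O = "{(m, n). odd (m + n)} :: (int \<times> int) set"
  have s2: "2 * s > 0" and ed: "\<bar>e * d\<bar> = 1" using s e d by (auto simp: abs_mult)
  have nz: "e \<noteq> 0" "d \<noteq> 0" using e d by auto
  \<comment> \<open>(i + j, i - j) is, up to conjugation, the product of 1 + i with a Gaussian
    integer; the norm doubles, hence the parameter \<open>2 * s\<close>.\<close>
  have bijE: "bij_betw (\<lambda>(i, j). (i + j, i - j)) UNIV ?E"
    by (rule bij_betw_byWitness[where f' = "\<lambda>(m, n). ((m + n) div 2, (m - n) div 2)"]) (auto, presburger+)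
  have bijO: "bij_betw (\<lambda>(i, j). (i + j + 1, i - j)) UNIV ?O"
    by (rule bij_betw_byWitness[where f' = "\<lambda>(m, n). ((m + n) div 2, (m - n) div 2)"]) (auto, presburger+)
  have sgn: "e powi (i + j) * d powi (i - j) = (e * d) powi i * (e * d) powi j" for i j
    using nz sign_powi_uminus[OF d, of j] power_int_add[of d i "- j"] power_int_add[of e i j]
    by (simp add: power_int_mult_distrib)
  have "(?f has_sum ?X) ?E"
  proof (subst has_sum_reindex_bij_betw[OF bijE, symmetric], rule iffD1[OF has_sum_cong])
    show "((\<lambda>(m, n). (e * d) powi m * (e * d) powi n * exp (- (2 * s * (of_int m + (a + b) / 2)\<^sup>2
        + 2 * s * (of_int n + (a - b) / 2)\<^sup>2))) has_sum ?X) UNIV"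
      by (rule has_sum_theta_times[OF s2 ed s2 ed])
    show "(case x of (m, n) \<Rightarrow> (e * d) powi m * (e * d) powi n * exp (- (2 * s * (of_int m + (a + b) / 2)\<^sup>2
        + 2 * s * (of_int n + (a - b) / 2)\<^sup>2))) = ?f (case x of (i, j) \<Rightarrow> (i + j, i - j))" for x
    proof (cases x)
      case (Pair i j)
      have "2 * s * (of_int i + (a + b) / 2)\<^sup>2 + 2 * s * (of_int j + (a - b) / 2)\<^sup>2
          = s * (of_int (i + j) + a)\<^sup>2 + s * (of_int (i - j) + b)\<^sup>2"
        by (simp add: power2_eq_square field_simps)
      then show ?thesis by (simp only: Pair prod.case sgn)
    qed
  qed
  moreover have "(?f has_sum e * ?Y) ?O"
  proof (subst has_sum_reindex_bij_betw[OF bijO, symmetric], rule iffD1[OF has_sum_cong])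
    show "((\<lambda>x. e * (case x of (m, n) \<Rightarrow> (e * d) powi m * (e * d) powi n * exp (- (2 * s * (of_int m + (a + b + 1) / 2)\<^sup>2
        + 2 * s * (of_int n + (a - b + 1) / 2)\<^sup>2)))) has_sum e * ?Y) UNIV"
      by (rule has_sum_cmult_right[OF has_sum_theta_times[OF s2 ed s2 ed]])
    show "e * (case x of (m, n) \<Rightarrow> (e * d) powi m * (e * d) powi n * exp (- (2 * s * (of_int m + (a + b + 1) / 2)\<^sup>2
        + 2 * s * (of_int n + (a - b + 1) / 2)\<^sup>2))) = ?f (case x of (i, j) \<Rightarrow> (i + j + 1, i - j))" for x
    proof (cases x)
      case (Pair i j)
      have "2 * s * (of_int i + (a + b + 1) / 2)\<^sup>2 + 2 * s * (of_int j + (a - b + 1) / 2)\<^sup>2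
          = s * (of_int (i + j + 1) + a)\<^sup>2 + s * (of_int (i - j) + b)\<^sup>2"
        by (simp add: power2_eq_square field_simps)
      moreover have "e powi (i + j + 1) * d powi (i - j) = e * ((e * d) powi i * (e * d) powi j)"
        using nz sgn[of i j] power_int_add[of e "i + j" 1] by simp
      ultimately show ?thesis by (simp only: Pair prod.case flip: mult.assoc)
    qed
  qed
  ultimately have "(?f has_sum ?X + e * ?Y) (?E \<union> ?O)"
    by (rule has_sum_Un_disjoint) auto
  moreover have "?E \<union> ?O = UNIV" by auto
  ultimately have "(?f has_sum ?X + e * ?Y) UNIV" by simp
  with has_sum_theta_times[OF s e s d] show ?thesis
    using has_sum_unique by blast
qed

text \<open>On integer pairs 1 - (-1)^(m + n) is 2 for odd m + n and 0 otherwise, so the two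
  products with shift 0 differ by twice a sum over odd m + n, weighted by the norm m^2 + 3 n^2 of m
  + n sqrt (-3). A sixth root of unity carries one half of the half-integer points onto these pairs
  without changing the norm.\<close>

lemma theta_cubic:
  assumes s: "s > 0"
  shows "theta 1 s 0 * theta 1 (3 * s) 0 =
    theta (-1) s 0 * theta (-1) (3 * s) 0 + theta 1 s (1/2) * theta 1 (3 * s) (1/2)"
proof -
  let ?g = "\<lambda>(m::int, n::int). exp (- (s * (of_int m)\<^sup>2 + 3 * s * (of_int n)\<^sup>2))"
  let ?h = "\<lambda>(m::int, n::int). exp (- (s * (of_int m + 1/2)\<^sup>2 + 3 * s * (of_int n + 1/2)\<^sup>2))"
  let ?E = "{(m, n). even (m + n)} :: (int \<times> int) set"
  let ?O = "{(m, n). odd (m + n)} :: (int \<times> int) set"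
  have s3: "3 * s > 0" using s by simp
  have h: "(?h has_sum theta 1 s (1/2) * theta 1 (3 * s) (1/2)) UNIV"
    using has_sum_theta_times[OF s _ s3, of 1 1 "1/2" "1/2"] by simp
  have UN: "?E \<union> ?O = UNIV" by auto
  have "?h summable_on ?E"
    using h has_sum_imp_summable summable_on_subset_banach by blast
  then obtain H where H: "(?h has_sum H) ?E" using has_sum_infsum by blast
  \<comment> \<open>Negating the first half-integer coordinate m + 1/2 swaps the two parity classes,
    so each contributes the same \<open>H\<close>.\<close>
  have bij: "bij_betw (\<lambda>(m, n). (- 1 - m, n)) ?E ?O"
    by (rule bij_betw_byWitness[where f' = "\<lambda>(m, n). (- 1 - m, n)"]) auto
  have "(?h has_sum H) ?O"
  proof (subst has_sum_reindex_bij_betw[OF bij, symmetric], rule iffD1[OF has_sum_cong H])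
    show "?h x = ?h (case x of (m, n) \<Rightarrow> (- 1 - m, n))" for x
      by (cases x) (simp add: power2_eq_square algebra_simps)
  qed
  with H have "(?h has_sum H + H) (?E \<union> ?O)"
    by (rule has_sum_Un_disjoint) auto
  then have hH: "theta 1 s (1/2) * theta 1 (3 * s) (1/2) = 2 * H"
    unfolding UN using h has_sum_unique by fastforce
  \<comment> \<open>With x = m + 1/2 and y = n + 1/2 this is ((x + 3 y) / 2, (x - y) / 2): the
    conjugate x - y sqrt (-3) multiplied by (1 + sqrt (-3)) / 2. The coordinates of the image have
    the odd sum x + y = m + n + 1.\<close>
  have bij': "bij_betw (\<lambda>(m, n). ((m - n) div 2 + 2 * n + 1, (m - n) div 2)) ?E ?O"
    by (rule bij_betw_byWitness[where f' = "\<lambda>(m, n). (2 * n + (m - n - 1) div 2, (m - n - 1) div 2)"])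
       (clarsimp; presburger)+
  have gO: "(?g has_sum H) ?O"
  proof (subst has_sum_reindex_bij_betw[OF bij', symmetric], rule iffD1[OF has_sum_cong H])
    fix x assume "x \<in> ?E"
    then obtain m n where mn: "x = (m, n)" "even (m + n)" by auto
    then obtain j where j: "m - n = 2 * j" by (metis evenE even_add even_diff)
    then have "m = n + 2 * j" by simp
    then show "?h x = ?g (case x of (m, n) \<Rightarrow> ((m - n) div 2 + 2 * n + 1, (m - n) div 2))"
      by (simp add: mn power2_eq_square algebra_simps)
  qed
  have diff: "((\<lambda>x. (case x of (m, n) \<Rightarrow> ?g (m, n)) - (case x of (m, n) \<Rightarrow> (-1) powi m * (-1) powi n * ?g (m, n)))
     has_sum theta 1 s 0 * theta 1 (3 * s) 0 - theta (-1) s 0 * theta (-1) (3 * s) 0) UNIV"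
    using has_sum_add[OF has_sum_theta_times[OF s _ s3, of 1 1 0 0]
      has_sum_uminusI[OF has_sum_theta_times[OF s _ s3, of "-1" "-1" 0 0]]]
    by (simp add: case_prod_unfold)
  have sgn: "(-1) powi m * (-1) powi n = (if even (m + n) then 1 else (-1::real))" for m n
    by (auto simp: power_int_minus_left)
  have "((\<lambda>x. 2 * ?g x) has_sum 2 * H) ?O"
    by (rule has_sum_cmult_right[OF gO])
  also have "?this \<longleftrightarrow> ((\<lambda>x. (case x of (m, n) \<Rightarrow> ?g (m, n)) - (case x of (m, n) \<Rightarrow> (-1) powi m * (-1) powi n * ?g (m, n)))
     has_sum 2 * H) UNIV"
    by (rule has_sum_cong_neutral) (auto simp: sgn split: if_splits)
  finally show ?thesis
    using diff hH has_sum_unique by fastforce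
qed

text \<open>The ideal of 2 + i has index 5 and norm 5, and the integers \<open>k\<close> from -2 to
  2 represent its cosets. The shifts are the coordinates of (k + a + i b) / (2 + i).\<close>

lemma theta_rotate_5:
  assumes s: "s > 0" and e: "\<bar>e\<bar> = 1"
  shows "theta e s a * theta e s b = (\<Sum>k\<in>{-2..2}. e powi k *
     (theta e (5 * s) ((2 * of_int k + 2 * a + b) / 5) * theta e (5 * s) ((2 * b - a - of_int k) / 5)))"
    (is "_ = (\<Sum>k\<in>_. e powi k * ?X k)")
proof -
  let ?f = "\<lambda>(m::int, n::int). e powi m * e powi n *
      exp (- (s * (of_int m + a)\<^sup>2 + s * (of_int n + b)\<^sup>2))"
  \<comment> \<open>(m, n) lies in the coset of (k, 0) iff m - 2 n is congruent to k modulo 5;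
    adding 2 moves the symmetric representatives to the remainders 0 to 4.\<close>
  let ?A = "\<lambda>k::int. {(m, n). (m - 2 * n + 2) mod 5 = k + 2} :: (int \<times> int) set"
  have s5: "5 * s > 0" using s by simp
  have nz: "e \<noteq> 0" using e by auto
  have part: "(?f has_sum e powi k * ?X k) (?A k)" if k: "k \<in> {-2..2}" for k
  proof -
    have bij: "bij_betw (\<lambda>(u, v). (k + 2 * u - v, u + 2 * v)) UNIV (?A k)"
    proof (rule bij_betw_byWitness[where f' = "\<lambda>(m, n). ((2 * (m - k) + n) div 5, (2 * n - m + k) div 5)"])
      show "\<forall>x\<in>?A k. (case case x of (m, n) \<Rightarrow> ((2 * (m - k) + n) div 5, (2 * n - m + k) div 5) of
            (u, v) \<Rightarrow> (k + 2 * u - v, u + 2 * v)) = x"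
      proof
        fix x assume "x \<in> ?A k"
        then obtain m n where x: "x = (m, n)" and *: "(m - 2 * n + 2) mod 5 = k + 2" by auto
        define t where "t = (m - 2 * n + 2) div 5"
        have "m = k + 5 * t + 2 * n"
          using div_mult_mod_eq[of "m - 2 * n + 2" 5] * by (simp add: t_def)
        then have "2 * (m - k) + n = 5 * (2 * t + n)" "2 * n - m + k = 5 * (- t)" by simp_all
        then have "(2 * (m - k) + n) div 5 = 2 * t + n" "(2 * n - m + k) div 5 = - t"
          by (simp_all only: nonzero_mult_div_cancel_left)
        then show "(case case x of (m, n) \<Rightarrow> ((2 * (m - k) + n) div 5, (2 * n - m + k) div 5) of
            (u, v) \<Rightarrow> (k + 2 * u - v, u + 2 * v)) = x"
          using \<open>m = k + 5 * t + 2 * n\<close> by (simp only: x prod.case) simp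
      qed
      show "(\<lambda>(u, v). (k + 2 * u - v, u + 2 * v)) ` UNIV \<subseteq> ?A k"
        using k by (auto, presburger)
    qed auto
    show ?thesis
    proof (subst has_sum_reindex_bij_betw[OF bij, symmetric], rule iffD1[OF has_sum_cong])
      show "((\<lambda>x. e powi k * (case x of (m, n) \<Rightarrow> e powi m * e powi n *
          exp (- (5 * s * (of_int m + (2 * of_int k + 2 * a + b) / 5)\<^sup>2
           + 5 * s * (of_int n + (2 * b - a - of_int k) / 5)\<^sup>2)))) has_sum e powi k * ?X k) UNIV"
        by (rule has_sum_cmult_right[OF has_sum_theta_times[OF s5 e s5 e]])
      show "e powi k * (case x of (m, n) \<Rightarrow> e powi m * e powi n *
          exp (- (5 * s * (of_int m + (2 * of_int k + 2 * a + b) / 5)\<^sup>2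
           + 5 * s * (of_int n + (2 * b - a - of_int k) / 5)\<^sup>2))) =
         ?f (case x of (u, v) \<Rightarrow> (k + 2 * u - v, u + 2 * v))" for x
      proof (cases x)
        case (Pair u v)
        have "5 * s * (of_int u + (2 * of_int k + 2 * a + b) / 5)\<^sup>2 + 5 * s * (of_int v + (2 * b - a - of_int k) / 5)\<^sup>2
           = s * (of_int (k + 2 * u - v) + a)\<^sup>2 + s * (of_int (u + 2 * v) + b)\<^sup>2"
          by (simp add: power2_eq_square field_simps)
        moreover have "e powi (k + 2 * u - v) * e powi (u + 2 * v) = e powi k * (e powi u * e powi v)"
        proof -
          have "e powi (k + 2 * u - v) * e powi (u + 2 * v) = e powi (k + u + v + 2 * u)"
            using nz by (simp add: algebra_simps flip: power_int_add)
          also have "\<dots> = e powi k * (e powi u * e powi v) * e powi (u + u)"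
            using nz power_int_add[of e "k + u + v" "2 * u"] power_int_add[of e "k + u" v] power_int_add[of e k u]
            by simp
          also have "e powi (u + u) = 1"
            using nz sign_powi_mult_self[OF e, of u] power_int_add[of e u u] by simp
          finally show ?thesis by simp
        qed
        ultimately show ?thesis by (simp only: Pair prod.case flip: mult.assoc)
      qed
    qed
  qed
  have "(?f has_sum (\<Sum>k\<in>{-2..2}. e powi k * ?X k)) (\<Union>k\<in>{-2..2}. ?A k)"
    by (rule sum_has_sum) (use part in auto)
  moreover have "(\<Union>k\<in>{-2..2}. ?A k) = UNIV"
  proof (intro equalityI subsetI UNIV_I)
    fix x :: "int \<times> int"
    obtain m n where x: "x = (m, n)" by (cases x)
    have "0 \<le> (m - 2 * n + 2) mod 5" "(m - 2 * n + 2) mod 5 < 5" by simp_all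
    then show "x \<in> (\<Union>k\<in>{-2..2}. ?A k)"
      unfolding x by (intro UN_I[of "(m - 2 * n + 2) mod 5 - 2"]) auto
  qed
  ultimately have "(?f has_sum (\<Sum>k\<in>{-2..2}. e powi k * ?X k)) UNIV" by simp
  with has_sum_theta_times[OF s e s e] show ?thesis
    using has_sum_unique by blast
qed

text \<open>Jacobi's theta constants at the nome \<open>exp (- s)\<close>.\<close>

abbreviation "theta2 s \<equiv> theta 1 s (1/2)"
abbreviation "theta3 s \<equiv> theta 1 s 0"
abbreviation "theta4 s \<equiv> theta (-1) s 0"

lemma theta_pos:
  assumes "s > 0"
  shows "theta 1 s a > 0"
  by (rule has_sum_strict_mono[OF _ has_sum_theta[OF assms, of 1 a], of "\<lambda>_. 0" 0 0]) auto

text \<open>The terms n and -1 - n cancel. This removes the second product when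
  \<open>theta_rotate_45\<close> is applied to opposite signs and equal shifts.\<close>

lemma theta_neg_half:
  assumes "s > 0"
  shows "theta (-1) s (1/2) = 0"
  using theta_shift[OF assms, of "-1" "-1/2"] theta_uminus[OF assms, of "-1" "1/2"] by simp

lemma theta_three_quarters:
  assumes "s > 0"
  shows "theta 1 s (3/4) = theta 1 s (1/4)"
  using theta_shift[OF assms, of 1 "-1/4"] theta_uminus[OF assms, of 1 "1/4"] by simp

lemma theta3_square:
  assumes "s > 0"
  shows "(theta3 s)\<^sup>2 = (theta3 (2 * s))\<^sup>2 + (theta2 (2 * s))\<^sup>2"
  using theta_rotate_45[OF assms, of 1 1 0 0] by (simp add: power2_eq_square)

lemma theta4_square:
  assumes "s > 0"
  shows "(theta4 s)\<^sup>2 = (theta3 (2 * s))\<^sup>2 - (theta2 (2 * s))\<^sup>2"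
  using theta_rotate_45[OF assms, of "-1" "-1" 0 0] by (simp add: power2_eq_square)

lemma theta2_square:
  assumes "s > 0"
  shows "(theta2 s)\<^sup>2 = 2 * theta2 (2 * s) * theta3 (2 * s)"
  using theta_rotate_45[OF assms, of 1 1 "1/2" "1/2"] theta_shift[of "2 * s" 1 0] assms
  by (simp add: power2_eq_square)

lemma theta3_theta4:
  assumes "s > 0"
  shows "theta3 s * theta4 s = (theta4 (2 * s))\<^sup>2"
  using theta_rotate_45[OF assms, of 1 "-1" 0 0] theta_neg_half[of "2 * s"] assms
  by (simp add: power2_eq_square)

text \<open>Jacobi's identity, here an instance of (x^2 + y^2)^2 = (2 x y)^2 + (x^2 - y^2)^2 at the
  doubled parameter.\<close>

lemma theta_quartic:
  assumes "s > 0"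
  shows "theta3 s ^ 4 = theta2 s ^ 4 + theta4 s ^ 4"
proof -
  have "x ^ 4 = (x\<^sup>2)\<^sup>2" for x :: real by simp
  then show ?thesis
    by (simp only: theta2_square[OF assms] theta3_square[OF assms] theta4_square[OF assms])
       (simp add: power2_eq_square algebra_simps)
qed

lemma theta_mult_theta_neg:
  assumes "s > 0"
  shows "theta 1 s a * theta (-1) s a = theta (-1) (2 * s) a * theta4 (2 * s)"
  using theta_rotate_45[OF assms, of 1 "-1" a a] theta_neg_half[of "2 * s"] assms by simp

text \<open>The shifts add up to 1/2, so both products of the rotation contain the value at 1/4 (or
  3/4, which is equal). The remaining factors are the even and odd halves of one series at s /
  2.\<close>

lemma theta_mult_theta_half_minus:
  assumes "s > 0"
  shows "theta 1 s a * theta 1 s (1/2 - a) = theta2 (s / 2) * theta 1 (s / 2) (2 * a - 1/2) / 2"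
proof -
  have s: "2 * s > 0" "s / 2 > 0" using assms by auto
  have eqs: "(a + (1/2 - a)) / 2 = 1/4" "(a - (1/2 - a)) / 2 = a - 1/4"
    "(a + (1/2 - a) + 1) / 2 = 3/4" "(a - (1/2 - a) + 1) / 2 = a + 1/4"
    "(2 * a - 1/2) / 2 = a - 1/4" "(2 * a - 1/2 + 1) / 2 = a + 1/4" "(1/2 + 1) / 2 = (3/4 :: real)"
    "1/2/2 = (1/4 :: real)" "4 * (s / 2) = 2 * s"
    by (simp_all add: field_simps)
  have "theta2 (s / 2) = 2 * theta 1 (2 * s) (1/4)"
    using theta_split[OF s(2), of "1/2"] theta_three_quarters[OF s(1)] by (simp only: eqs)
  moreover have "theta 1 (s / 2) (2 * a - 1/2) = theta 1 (2 * s) (a - 1/4) + theta 1 (2 * s) (a + 1/4)"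
    using theta_split[OF s(2), of "2 * a - 1/2"] by (simp only: eqs)
  ultimately show ?thesis
    using theta_rotate_45[OF assms, of 1 1 a "1/2 - a"] theta_three_quarters[OF s(1)]
    by (simp only: eqs mult_1 abs_1) (simp add: algebra_simps)
qed

text \<open>The coset k = 0 gives the square. The other four coincide after reflection and the shift
  from -1/5 to 4/5, whose sign matches that of the coset.\<close>

lemma theta4_square_quintic:
  assumes "s > 0"
  shows "(theta4 s)\<^sup>2 = (theta4 (5 * s))\<^sup>2 - 4 * theta (-1) (5 * s) (2/5) * theta (-1) (5 * s) (1/5)"
proof -
  let ?t = "theta (-1) (5 * s)"
  have s5: "5 * s > 0" using assms by simp
  have I: "{-2..2::int} = {-2, -1, 0, 1, 2}" by auto
  have um: "?t (- x) = ?t x" for x using theta_uminus[OF s5, of "-1"] by simp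
  have "?t (4/5) = - ?t (1/5)"
    using theta_shift[OF s5, of "-1" "-1/5"] um[of "1/5"] by simp
  then have *: "?t (4/5) = - ?t (1/5)" "?t (-(4/5)) = - ?t (1/5)" by (simp_all only: um)
  show ?thesis
    using theta_rotate_5[OF assms, of "-1" 0 0]
    by (simp add: I * um power2_eq_square)
qed

text \<open>Here the coset k = -2 has the shifts -1/2 and 1/2 and gives the square; the other four
  coincide.\<close>

lemma theta2_square_quintic:
  assumes "s > 0"
  shows "(theta2 s)\<^sup>2 = (theta2 (5 * s))\<^sup>2 + 4 * theta 1 (5 * s) (3/10) * theta 1 (5 * s) (1/10)"
proof -
  let ?t = "theta 1 (5 * s)"
  have s5: "5 * s > 0" using assms by simp
  have I: "{-2..2::int} = {-2, -1, 0, 1, 2}" by auto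
  have um: "?t (- x) = ?t x" for x using theta_uminus[OF s5, of 1] by simp
  have *: "?t (7/10) = ?t (3/10)" "?t (11/10) = ?t (1/10)"
    using theta_shift[OF s5, of 1 "-3/10"] um[of "3/10"] theta_shift[OF s5, of 1 "1/10"] by simp_all
  show ?thesis
    using theta_rotate_5[OF assms, of 1 "1/2" "1/2"]
    by (simp add: I * um power2_eq_square)
qed

section \<open>Asymptotics in s, and the degree 5 identity\<close>

lemma theta_tendsto:
  assumes a: "\<bar>a\<bar> < 1/2" and e: "\<bar>e\<bar> = 1"
  shows "((\<lambda>s. theta e s a * exp (s * a\<^sup>2)) \<longlongrightarrow> 1) at_top"
proof -
  \<comment> \<open>The term n = 0 dominates: relative to it every other exponent gains
    \<open>d n\<close>, which is at least \<open>c\<close>, and \<open>c\<close> is positive since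
    |a| < 1/2.\<close>
  define c where "c = 1 - 2 * \<bar>a\<bar>"
  have c: "c > 0" using a by (simp add: c_def)
  define d where "d = (\<lambda>n::int. (of_int n + a)\<^sup>2 - a\<^sup>2)"
  have d: "d n \<ge> c" if "n \<noteq> 0" for n
  proof -
    have n1: "1 \<le> \<bar>of_int n :: real\<bar>" using that by (simp flip: of_int_abs)
    have "d n = \<bar>of_int n\<bar> * \<bar>of_int n\<bar> + 2 * of_int n * a"
      by (simp add: d_def power2_eq_square algebra_simps)
    moreover have "- (\<bar>of_int n\<bar> * \<bar>a\<bar>) \<le> of_int n * a"
      by (simp flip: abs_mult)
    ultimately have "d n \<ge> \<bar>of_int n\<bar> * (\<bar>of_int n\<bar> - 2 * \<bar>a\<bar>)"
      by (simp add: algebra_simps)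
    moreover have "1 * (1 - 2 * \<bar>a\<bar>) \<le> \<bar>of_int n\<bar> * (\<bar>of_int n\<bar> - 2 * \<bar>a\<bar>)"
      using n1 a by (intro mult_mono) auto
    ultimately show ?thesis by (simp add: c_def)
  qed
  \<comment> \<open>One unit of s is held back to keep the series convergent, with sum
    \<open>C\<close>; the remaining s - 1 supplies the decay exp (- (s - 1) c).\<close>
  define C where "C = theta 1 1 a * exp (a\<^sup>2)"
  have bound: "\<bar>theta e s a * exp (s * a\<^sup>2) - 1\<bar> \<le> exp (- (s - 1) * c) * C" if s: "s \<ge> 1" for s
  proof -
    have s0: "s > 0" using s by simp
    have eq: "exp (- s * (of_int n + a)\<^sup>2) * exp (s * a\<^sup>2) = exp (- s * d n)" for n s
      by (simp add: d_def algebra_simps flip: exp_add)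
    have 1: "((\<lambda>n. e powi n * exp (- s * d n)) has_sum theta e s a * exp (s * a\<^sup>2)) UNIV"
      using has_sum_cmult_left[OF has_sum_theta[OF s0 e, of a], of "exp (s * a\<^sup>2)"] 
      by (simp only: mult.assoc eq)
    have 2: "((\<lambda>n. exp (- (s - 1) * c) * exp (- d n)) has_sum exp (- (s - 1) * c) * C) UNIV"
      using has_sum_cmult_right[OF has_sum_cmult_left[OF has_sum_theta[of 1 1 a], of "exp (a\<^sup>2)"], of "exp (- (s - 1) * c)"] eq[of 1] 
      by (simp add: C_def mult.assoc)
    have "((\<lambda>n. if n = 0 then - 1 else 0) has_sum - 1) (UNIV :: int set)"
      by (rule has_sum_finite_neutralI[of "{0}"]) auto
    then have 3: "((\<lambda>n. e powi n * exp (- s * d n) + (if n = 0 then - 1 else 0)) has_sum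
       theta e s a * exp (s * a\<^sup>2) + - 1) UNIV"
      by (rule has_sum_add[OF 1])
    have term_le: "\<bar>e powi n * exp (- s * d n) + (if n = 0 then - 1 else 0)\<bar> \<le> exp (- (s - 1) * c) * exp (- d n)" for n
    proof (cases "n = 0")
      case False
      have "(s - 1) * c \<le> (s - 1) * d n" using s d[OF False] by (intro mult_left_mono) auto
      then have "exp (- s * d n) \<le> exp (- (s - 1) * c) * exp (- d n)"
        by (simp add: algebra_simps flip: exp_add)
      then show ?thesis using False e by (simp add: abs_mult power_int_abs)
    qed (simp add: d_def)
    have "theta e s a * exp (s * a\<^sup>2) + - 1 \<le> exp (- (s - 1) * c) * C"
      by (rule has_sum_mono[OF 3 2]) (meson term_le abs_le_D1)
    moreover have "- (theta e s a * exp (s * a\<^sup>2) + - 1) \<le> exp (- (s - 1) * c) * C"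
      by (rule has_sum_mono[OF has_sum_uminusI[OF 3] 2]) (meson term_le abs_le_D2)
    ultimately show ?thesis by (simp add: abs_le_iff)
  qed
  have "((\<lambda>s. exp (- (s - 1) * c) * C) \<longlongrightarrow> 0) at_top"
    using c by real_asymp
  moreover have "eventually (\<lambda>s. norm (theta e s a * exp (s * a\<^sup>2) - 1) \<le> exp (- (s - 1) * c) * C) at_top"
    unfolding real_norm_def using bound by (rule eventually_at_top_linorderI)
  ultimately have "((\<lambda>s. theta e s a * exp (s * a\<^sup>2) - 1) \<longlongrightarrow> 0) at_top"
    by (rule Lim_null_comparison[rotated])
  then show ?thesis by (simp add: LIM_zero_iff)
qed

text \<open>At shift 1/2 the terms 0 and -1 tie for the largest, which puts \<open>theta2\<close>
  outside \<open>theta_tendsto\<close>; at shift 1/4 one term dominates.\<close>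

lemma theta2_eq_theta_quarter:
  assumes "s > 0"
  shows "theta2 s = 2 * theta 1 (4 * s) (1/4)"
  using theta_split[OF assms, of "1/2"] theta_three_quarters[of "4 * s"] assms by simp

lemma theta2_tendsto: "((\<lambda>s. theta2 s * exp (s / 4)) \<longlongrightarrow> 2) at_top"
proof -
  have "filterlim (\<lambda>s::real. 4 * s) at_top at_top" by real_asymp
  from filterlim_compose[OF theta_tendsto[of "1/4" 1] this]
  have "((\<lambda>s. 2 * (theta 1 (4 * s) (1/4) * exp (4 * s * (1/4)\<^sup>2))) \<longlongrightarrow> 2 * 1) at_top"
    by (intro tendsto_mult_left) auto
  moreover have "eventually (\<lambda>s. 2 * (theta 1 (4 * s) (1/4) * exp (4 * s * (1/4)\<^sup>2)) = theta2 s * exp (s / 4)) at_top"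
    using eventually_gt_at_top[of "0::real"]
    by eventually_elim (simp add: theta2_eq_theta_quarter power2_eq_square)
  ultimately show ?thesis
    by (simp add: tendsto_cong)
qed

lemma constant_if_doubling:
  fixes f :: "real \<Rightarrow> real"
  assumes double: "\<And>s. s > 0 \<Longrightarrow> f (2 * s) = f s"
    and lim: "(f \<longlongrightarrow> l) at_top" and s: "s > 0"
  shows "f s = l"
proof -
  have "f (2 ^ n * s) = f s" for n
  proof (induction n)
    case (Suc n)
    then show ?case using double[of "2 ^ n * s"] s by (simp add: mult.assoc)
  qed simp
  moreover have "filterlim (\<lambda>n::nat. 2 ^ n * s) at_top sequentially"
    using s by real_asymp
  ultimately have "(\<lambda>n::nat. f s) \<longlonglongrightarrow> l"
    using filterlim_compose[OF lim, of "\<lambda>n. 2 ^ n * s" sequentially] by simp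
  then show ?thesis by (simp add: LIMSEQ_const_iff)
qed

text \<open>The series alternates, so positivity is not termwise. A zero at s would propagate to all
  2^n s by \<open>theta3_theta4\<close>, against the limit 1. Hence
  \<open>theta3 s * theta4 s\<close>, being a nonzero square, is positive.\<close>

lemma theta4_pos:
  assumes s: "s > 0"
  shows "theta4 s > 0"
proof -
  have nz: "theta4 s \<noteq> 0" if s: "s > 0" for s
  proof
    assume 0: "theta4 s = 0"
    have "theta4 (2 ^ n * s) = 0" for n
    proof (induction n)
      case (Suc n)
      then show ?case using theta3_theta4[of "2 ^ n * s"] s by (simp add: mult.assoc)
    qed (use 0 in simp)
    moreover have "filterlim (\<lambda>n::nat. 2 ^ n * s) at_top sequentially"
      using s by real_asymp
    ultimately show False
      using filterlim_compose[OF theta_tendsto[of 0 "-1"], of "\<lambda>n. 2 ^ n * s" sequentially]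
      by (simp add: LIMSEQ_const_iff)
  qed
  have "0 < (theta4 (2 * s))\<^sup>2" using nz[of "2 * s"] s by simp
  then have "0 < theta3 s * theta4 s" by (simp only: theta3_theta4[OF s])
  then show ?thesis using theta_pos[OF s, of 0] by (simp add: zero_less_mult_iff)
qed

text \<open>The quotient of the two sides is invariant under \<open>s \<mapsto> 2 s\<close> and tends to 1; this takes the place
  of the product expansions of the four theta functions.\<close>

lemma theta_quintic_product:
  assumes s: "s > 0"
  shows "4 * theta 1 (s / 2) (3/10) * theta 1 (s / 2) (1/10) * theta (-1) s (2/5) * theta (-1) s (1/5)
     = (theta4 s)\<^sup>2 * (theta2 (s / 2))\<^sup>2"
proof -
  define F where "F = (\<lambda>s. 4 * theta 1 (s / 2) (3/10) * theta 1 (s / 2) (1/10) * theta (-1) s (2/5) * theta (-1) s (1/5))"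
  define G where "G = (\<lambda>s. (theta4 s)\<^sup>2 * (theta2 (s / 2))\<^sup>2)"
  \<comment> \<open>The halving identity pairs the shifts 1/10 with 2/5 and 1/5 with 3/10. Applied
    backwards it brings the tenths from s / 2 to s, where \<open>theta_mult_theta_neg\<close> takes
    all fifths to 2 s. \<open>G\<close> satisfies the same recursion.\<close>
  have F: "F s * (theta2 (s / 2))\<^sup>2 = 4 * (F (2 * s) * (theta4 (2 * s))\<^sup>2)" if "s > 0" for s
  proof -
    have 1: "theta 1 s (1/10) * theta 1 s (2/5) = theta2 (s / 2) * theta 1 (s / 2) (3/10) / 2"
      using theta_mult_theta_half_minus[OF that, of "1/10"] theta_uminus[of "s / 2" 1 "3/10"] that by simp
    have 2: "theta 1 s (1/5) * theta 1 s (3/10) = theta2 (s / 2) * theta 1 (s / 2) (1/10) / 2"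
      using theta_mult_theta_half_minus[OF that, of "1/5"] theta_uminus[of "s / 2" 1 "1/10"] that by simp
    have "F s * (theta2 (s / 2))\<^sup>2 = 16 * (theta2 (s / 2) * theta 1 (s / 2) (3/10) / 2) *
        (theta2 (s / 2) * theta 1 (s / 2) (1/10) / 2) * theta (-1) s (2/5) * theta (-1) s (1/5)"
      by (simp add: F_def power2_eq_square)
    also have "\<dots> = 16 * theta 1 s (1/10) * theta 1 s (3/10) * (theta 1 s (2/5) * theta (-1) s (2/5)) *
        (theta 1 s (1/5) * theta (-1) s (1/5))"
      by (simp only: 1[symmetric] 2[symmetric] mult_ac)
    also have "\<dots> = 4 * (F (2 * s) * (theta4 (2 * s))\<^sup>2)"
      by (simp only: theta_mult_theta_neg[OF that]) (simp add: F_def power2_eq_square)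
    finally show ?thesis .
  qed
  have G: "G s * (theta2 (s / 2))\<^sup>2 = 4 * (G (2 * s) * (theta4 (2 * s))\<^sup>2)" if "s > 0" for s
  proof -
    have "(theta2 (s / 2))\<^sup>2 = 2 * theta2 s * theta3 s"
      using theta2_square[of "s / 2"] that by simp
    then have "G s * (theta2 (s / 2))\<^sup>2 = 4 * (theta2 s)\<^sup>2 * (theta3 s * theta4 s)\<^sup>2"
      by (simp add: G_def power2_eq_square)
    also have "\<dots> = 4 * (G (2 * s) * (theta4 (2 * s))\<^sup>2)"
      by (simp only: theta3_theta4[OF that]) (simp add: G_def power2_eq_square)
    finally show ?thesis .
  qed
  have G_pos: "G s > 0" if "s > 0" for s
    using theta4_pos[OF that] theta_pos[of "s / 2" "1/2"] that by (simp add: G_def)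
  have "F s / G s = 1"
  proof (rule constant_if_doubling[OF _ _ s])
    fix s :: real assume s: "s > 0"
    have t: "(theta2 (s / 2))\<^sup>2 > 0" using theta_pos[of "s / 2" "1/2"] s by simp
    have "(F s * G (2 * s)) * (theta2 (s / 2))\<^sup>2 = (F s * (theta2 (s / 2))\<^sup>2) * G (2 * s)"
      by (simp only: mult_ac)
    also have "\<dots> = F (2 * s) * (G s * (theta2 (s / 2))\<^sup>2)"
      by (simp only: F[OF s] G[OF s] mult_ac)
    finally have "(F s * G (2 * s)) * (theta2 (s / 2))\<^sup>2 = (F (2 * s) * G s) * (theta2 (s / 2))\<^sup>2"
      by (simp only: mult_ac)
    then have "F s * G (2 * s) = F (2 * s) * G s" using t by simp
    then show "F (2 * s) / G (2 * s) = F s / G s"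
      using G_pos[of s] G_pos[of "2 * s"] s by (simp add: field_simps)
  next
    have half: "filterlim (\<lambda>s::real. s / 2) at_top at_top" by real_asymp
    have "((\<lambda>s. 4 * (theta 1 (s / 2) (3/10) * exp (s / 2 * (3/10)\<^sup>2)) * (theta 1 (s / 2) (1/10) * exp (s / 2 * (1/10)\<^sup>2))
       * (theta (-1) s (2/5) * exp (s * (2/5)\<^sup>2)) * (theta (-1) s (1/5) * exp (s * (1/5)\<^sup>2))) \<longlongrightarrow> 4 * 1 * 1 * 1 * 1) at_top"
      by (intro tendsto_mult tendsto_const theta_tendsto
            filterlim_compose[OF theta_tendsto half]) auto
    also have "(\<lambda>s. 4 * (theta 1 (s / 2) (3/10) * exp (s / 2 * (3/10)\<^sup>2)) * (theta 1 (s / 2) (1/10) * exp (s / 2 * (1/10)\<^sup>2))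
       * (theta (-1) s (2/5) * exp (s * (2/5)\<^sup>2)) * (theta (-1) s (1/5) * exp (s * (1/5)\<^sup>2)))
       = (\<lambda>s. F s * exp (s / 4))"
    proof
      fix s :: real
      \<comment> \<open>The leading exponents 9/200, 1/200, 4/25 and 1/25 add up to 1/4, the
        exponent of \<open>theta2\<close> squared at s / 2, so \<open>F\<close> and \<open>G\<close>
        decay at the same rate.\<close>
      have "exp (s / 4) = exp (s / 2 * (3/10)\<^sup>2) * exp (s / 2 * (1/10)\<^sup>2) * exp (s * (2/5)\<^sup>2) * exp (s * (1/5)\<^sup>2)"
        by (simp add: power2_eq_square flip: exp_add)
      then show "4 * (theta 1 (s / 2) (3/10) * exp (s / 2 * (3/10)\<^sup>2)) * (theta 1 (s / 2) (1/10) * exp (s / 2 * (1/10)\<^sup>2))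
       * (theta (-1) s (2/5) * exp (s * (2/5)\<^sup>2)) * (theta (-1) s (1/5) * exp (s * (1/5)\<^sup>2)) = F s * exp (s / 4)"
        by (simp only: F_def mult_ac)
    qed
    finally have limF: "((\<lambda>s. F s * exp (s / 4)) \<longlongrightarrow> 4) at_top" by simp
    have "((\<lambda>s. (theta4 s * exp (s * 0\<^sup>2))\<^sup>2 * (theta2 (s / 2) * exp (s / 2 / 4))\<^sup>2) \<longlongrightarrow> 1\<^sup>2 * 2\<^sup>2) at_top"
      by (intro tendsto_mult tendsto_power theta_tendsto filterlim_compose[OF theta2_tendsto half]) auto
    also have "(\<lambda>s. (theta4 s * exp (s * 0\<^sup>2))\<^sup>2 * (theta2 (s / 2) * exp (s / 2 / 4))\<^sup>2) = (\<lambda>s. G s * exp (s / 4))"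
      by (simp add: G_def power_mult_distrib fun_eq_iff flip: exp_double)
    finally have limG: "((\<lambda>s. G s * exp (s / 4)) \<longlongrightarrow> 4) at_top" by simp
    show "((\<lambda>s. F s / G s) \<longlongrightarrow> 1) at_top"
      using tendsto_divide[OF limF limG] by simp
  qed
  then show ?thesis
    using G_pos[OF s] by (simp add: F_def G_def)
qed

text \<open>The factors on the left are 4 times the products at tenths and at fifths, which
  \<open>theta_quintic_product\<close> evaluates together.\<close>

lemma theta_quintic:
  assumes s: "s > 0"
  shows "((theta2 (s / 2))\<^sup>2 - (theta2 (5 * s / 2))\<^sup>2) * ((theta4 (5 * s))\<^sup>2 - (theta4 s)\<^sup>2)
     = 4 * (theta4 (5 * s))\<^sup>2 * (theta2 (5 * s / 2))\<^sup>2"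
  using theta_quintic_product[of "5 * s"] theta4_square_quintic[OF s] theta2_square_quintic[of "s / 2"] s
  by (simp add: mult_ac)

section \<open>Poisson summation\<close>

text \<open>Serves both sides of Poisson summation: the Gaussian series of theta and the cosine
  series built from its Fourier coefficients.\<close>

lemma has_integral_infsum_uniform:
  fixes f :: "'a \<Rightarrow> real \<Rightarrow> real"
  assumes cont: "\<And>n. continuous_on {a..b} (f n)"
    and M: "\<And>n y. y \<in> {a..b} \<Longrightarrow> \<bar>f n y\<bar> \<le> M n" "M summable_on UNIV"
    and int: "\<And>n. (f n has_integral i n) {a..b}"
  shows "continuous_on {a..b} (\<lambda>y. \<Sum>\<^sub>\<infinity>n. f n y)"
    and "\<exists>J. (i has_sum J) UNIV \<and> ((\<lambda>y. \<Sum>\<^sub>\<infinity>n. f n y) has_integral J) {a..b}"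
proof -
  let ?F = "finite_subsets_at_top (UNIV :: 'a set)"
  have u: "uniform_limit {a..b} (\<lambda>X y. \<Sum>n\<in>X. f n y) (\<lambda>y. \<Sum>\<^sub>\<infinity>n. f n y) ?F"
    using M by (intro Weierstrass_m_test_general) auto
  have c: "continuous_on {a..b} (\<lambda>y. \<Sum>n\<in>X. f n y)" for X
    by (intro continuous_on_sum cont)
  show "continuous_on {a..b} (\<lambda>y. \<Sum>\<^sub>\<infinity>n. f n y)"
    by (rule uniform_limit_theorem[OF _ u]) (auto intro: always_eventually c)
  obtain I J where IJ: "\<And>X. ((\<lambda>y. \<Sum>n\<in>X. f n y) has_integral I X) {a..b}"
      "((\<lambda>y. \<Sum>\<^sub>\<infinity>n. f n y) has_integral J) {a..b}" "(I \<longlongrightarrow> J) ?F"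
    by (rule uniform_limit_integral[OF u c]) auto
  have "I X = sum i X" if "finite X" for X
    using has_integral_unique[OF IJ(1)] has_integral_sum[OF that, of f i] int by blast
  then have "eventually (\<lambda>X. I X = sum i X) ?F"
    by (auto intro: eventually_finite_subsets_at_top_weakI)
  then have "(sum i \<longlongrightarrow> J) ?F"
    using IJ(3) by (simp add: tendsto_cong)
  then show "\<exists>J. (i has_sum J) UNIV \<and> ((\<lambda>y. \<Sum>\<^sub>\<infinity>n. f n y) has_integral J) {a..b}"
    using IJ(2) by (auto simp: has_sum_def)
qed

lemma has_integral_cos_period:
  "((\<lambda>x. cos (2 * pi * of_int k * x)) has_integral (if k = 0 then 1 else 0)) {0..1::real}"
proof (cases "k = 0")
  case True
  then show ?thesis using has_integral_const_real[of "1::real" 0 1] by simp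
next
  case False
  have "((\<lambda>x. cos (2 * pi * of_int k * x)) has_integral
      (sin (2 * pi * of_int k * 1) / (2 * pi * of_int k) - sin (2 * pi * of_int k * 0) / (2 * pi * of_int k))) {0..1}"
    by (rule fundamental_theorem_of_calculus)
       (use False in \<open>auto intro!: derivative_eq_intros simp flip: has_real_derivative_iff_has_vector_derivative\<close>)
  moreover have "sin (2 * pi * of_int k) = 0"
    using sin_int_2pin[of k] by (simp add: mult_ac)
  ultimately show ?thesis using False by simp
qed

lemma cos_int_mult_cos_int:
  "cos (2 * pi * of_int m * x) * cos (2 * pi * of_int k * x) =
    (cos (2 * pi * of_int (m + k) * x) + cos (2 * pi * of_int (m - k) * x)) / 2"
  using cos_times_cos[of "2 * pi * of_int m * x" "2 * pi * of_int k * x"] by (simp add: algebra_simps)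

lemma has_integral_cos_mult_cos:
  "((\<lambda>x. cos (2 * pi * of_int m * x) * cos (2 * pi * of_int k * x)) has_integral
     ((if m = - k then 1 else 0) + (if m = k then 1 else 0)) / 2) {0..1::real}"
proof -
  have "((\<lambda>x. (cos (2 * pi * of_int (m + k) * x) + cos (2 * pi * of_int (m - k) * x)) / 2) has_integral
     ((if m + k = 0 then 1 else 0) + (if m - k = 0 then 1 else 0)) / 2) {0..1::real}"
    by (intro has_integral_divide has_integral_add has_integral_cos_period)
  moreover have "(m + k = 0) = (m = - k)" "(m - k = 0) = (m = k)" by auto
  ultimately show ?thesis
    by (simp only: cos_int_mult_cos_int)
qed

text \<open>\<open>D\<close> is a continuous function of \<open>cos (2 \<pi> x)\<close>, hence a uniform limit of cosine polynomials, to all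
  of which it is orthogonal.\<close>

lemma even_periodic_eq_0:
  fixes D :: "real \<Rightarrow> real"
  assumes cont: "continuous_on {0..1} D"
    and sym: "\<And>x. D (1 - x) = D x"
    and coeff: "\<And>k::int. ((\<lambda>x. D x * cos (2 * pi * of_int k * x)) has_integral 0) {0..1}"
    and x: "x \<in> {0..1}"
  shows "D x = 0"
proof -
  \<comment> \<open>The product 2 cos (2 pi x) cos (2 pi k x) has the frequencies k + 1 and k - 1,
    so each power of the cosine is absorbed by changing \<open>k\<close>; this is why
    \<open>k\<close> is generalised in the induction.\<close>
  have pow: "((\<lambda>x. D x * cos (2 * pi * x) ^ j * cos (2 * pi * of_int k * x)) has_integral 0) {0..1}" for j k
  proof (induction j arbitrary: k)
    case 0
    then show ?case using coeff by simp
  next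
    case (Suc j)
    have "((\<lambda>x. (D x * cos (2 * pi * x) ^ j * cos (2 * pi * of_int (k + 1) * x) +
        D x * cos (2 * pi * x) ^ j * cos (2 * pi * of_int (k - 1) * x)) / 2) has_integral (0 + 0) / 2) {0..1}"
      by (intro has_integral_divide has_integral_add Suc)
    moreover have "(D x * cos (2 * pi * x) ^ j * cos (2 * pi * of_int (k + 1) * x) +
        D x * cos (2 * pi * x) ^ j * cos (2 * pi * of_int (k - 1) * x)) / 2 =
        D x * cos (2 * pi * x) ^ Suc j * cos (2 * pi * of_int k * x)" for x
    proof -
      have "cos (2 * pi * of_int (k + 1) * x) + cos (2 * pi * of_int (k - 1) * x) =
          2 * (cos (2 * pi * x) * cos (2 * pi * of_int k * x))"
        using cos_int_mult_cos_int[of k x 1] by (simp add: mult_ac)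
      then show ?thesis by (simp flip: distrib_left)
    qed
    ultimately show ?case by simp
  qed
  define E where "E = (\<lambda>y. D (arccos y / (2 * pi)))"
  have E: "E (cos (2 * pi * x)) = D x" if "x \<in> {0..1}" for x
  proof (cases "x \<le> 1/2")
    case True
    then have "2 * pi * x \<le> pi" using pi_gt_zero by (simp add: field_simps)
    then show ?thesis using that by (simp add: E_def arccos_cos)
  next
    case False
    then have "2 * pi * (1 - x) \<le> pi" using pi_gt_zero by (simp add: field_simps)
    moreover have "cos (2 * pi * x) = cos (2 * pi * (1 - x))"
      using cos_2pi_minus[of "2 * pi * x"] by (simp add: algebra_simps)
    ultimately show ?thesis using that sym[of x] by (simp add: E_def arccos_cos)
  qed
  have contE: "continuous_on {-1..1} E"
    unfolding E_def
  proof (rule continuous_on_compose2[OF cont])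
    show "continuous_on {-1..1} (\<lambda>y. arccos y / (2 * pi))"
      by (intro continuous_intros) auto
    show "(\<lambda>y. arccos y / (2 * pi)) ` {-1..1} \<subseteq> {0..1}"
      using arccos_lbound arccos_ubound pi_gt_zero by (fastforce simp: field_simps)
  qed
  have intD2: "(\<lambda>x. D x * D x) integrable_on {0..1}"
    by (intro integrable_continuous_interval continuous_intros cont)
  have intD: "(\<lambda>x. \<bar>D x\<bar>) integrable_on {0..1}"
    by (intro integrable_continuous_interval continuous_intros cont)
  define C where "C = integral {0..1} (\<lambda>x. \<bar>D x\<bar>)"
  have C: "C \<ge> 0" unfolding C_def by (intro integral_nonneg intD) auto
  \<comment> \<open>By orthogonality one factor of D^2 may be replaced by D - p (cos (2 pi x)),
    which is smaller than \<open>e\<close> in absolute value.\<close>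
  have le: "integral {0..1} (\<lambda>x. D x * D x) \<le> e * C" if e: "e > 0" for e
  proof -
    obtain p where p: "real_polynomial_function p" "\<And>y. y \<in> {-1..1} \<Longrightarrow> \<bar>E y - p y\<bar> < e"
      using Stone_Weierstrass_real_polynomial_function[OF _ contE e] by auto
    obtain a n where pa: "p = (\<lambda>y. \<Sum>i\<le>n. a i * y ^ i)"
      using p(1) real_polynomial_function_iff_sum by blast
    have "((\<lambda>x. \<Sum>i\<le>n. a i * (D x * cos (2 * pi * x) ^ i * cos (2 * pi * of_int 0 * x))) has_integral (\<Sum>i\<le>n. a i * 0)) {0..1}"
      by (intro has_integral_sum has_integral_mult_right pow) auto
    then have "((\<lambda>x. D x * p (cos (2 * pi * x))) has_integral 0) {0..1}"
      by (simp add: pa sum_distrib_left mult_ac)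
    from has_integral_diff[OF integrable_integral[OF intD2] this]
    have "((\<lambda>x. D x * (D x - p (cos (2 * pi * x)))) has_integral integral {0..1} (\<lambda>x. D x * D x)) {0..1}"
      by (simp add: algebra_simps)
    moreover have "((\<lambda>x. e * \<bar>D x\<bar>) has_integral e * C) {0..1}"
      unfolding C_def by (intro has_integral_mult_right integrable_integral intD)
    moreover have "D x * (D x - p (cos (2 * pi * x))) \<le> e * \<bar>D x\<bar>" if "x \<in> {0..1}" for x
    proof -
      have "\<bar>D x - p (cos (2 * pi * x))\<bar> < e"
        using p(2)[of "cos (2 * pi * x)"] E[OF that] by simp
      then have "\<bar>D x\<bar> * \<bar>D x - p (cos (2 * pi * x))\<bar> \<le> \<bar>D x\<bar> * e"
        by (intro mult_left_mono) auto
      then show ?thesis by (simp add: mult.commute flip: abs_mult)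
    qed
    ultimately show ?thesis by (rule has_integral_le)
  qed
  have "integral {0..1} (\<lambda>x. D x * D x) \<le> 0 + e" if "e > 0" for e
  proof -
    \<comment> \<open>The divisor C + 1 also covers C = 0.\<close>
    have "integral {0..1} (\<lambda>x. D x * D x) \<le> e / (C + 1) * C"
      using le[of "e / (C + 1)"] that C by simp
    also have "\<dots> \<le> e" using that C by (simp add: divide_le_eq)
    finally show ?thesis by simp
  qed
  then have "integral {0..1} (\<lambda>x. D x * D x) \<le> 0"
    by (rule field_le_epsilon)
  moreover have "integral {0..1} (\<lambda>x. D x * D x) \<ge> 0"
    by (intro integral_nonneg intD2) auto
  ultimately have "((\<lambda>x. D x * D x) has_integral 0) (cbox 0 1)"
    using integrable_integral[OF intD2] by simp
  then have "D x * D x = 0"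
    by (rule has_integral_0_cbox_imp_0[rotated 2]) (use x cont in \<open>auto intro!: continuous_intros\<close>)
  then show ?thesis by simp
qed

text \<open>The real part of the characteristic function of the standard normal distribution,
  rescaled: the substitution has (\<sigma> y)^2 / 2 = pi t y^2, and \<open>u\<close> makes the angle
  2 pi k y.\<close>

lemma has_integral_gauss_cos:
  assumes t: "t > 0"
  shows "((\<lambda>y. exp (- (pi * t) * y\<^sup>2) * cos (2 * pi * k * y)) has_integral
     exp (- (pi / t) * k\<^sup>2) / sqrt t) UNIV"
proof -
  define \<sigma> where "\<sigma> = sqrt (2 * pi * t)"
  define u where "u = 2 * pi * k / \<sigma>"
  have \<sigma>: "\<sigma> > 0" "\<sigma>\<^sup>2 = 2 * pi * t" using t by (auto simp: \<sigma>_def)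
  interpret real_distribution std_normal_distribution by (rule real_dist_normal_dist)
  have Re_iexp: "Re (iexp (u * x)) = cos (u * x)" for x
    by (metis cis.sel(1) cis_conv_exp)
  have "integrable std_normal_distribution (\<lambda>x. iexp (u * x))"
    by (rule integrable_iexp) auto
  then have int: "integrable std_normal_distribution (\<lambda>x. cos (u * x))"
    using integrable_Re[of std_normal_distribution "\<lambda>x. iexp (u * x)"] by (simp only: Re_iexp)
  have "(LINT x|std_normal_distribution. cos (u * x)) = Re (char std_normal_distribution u)"
    unfolding char_def using integral_Re[OF \<open>integrable _ (\<lambda>x. iexp (u * x))\<close>]
    by (simp only: Re_iexp)
  then have "(LINT x|std_normal_distribution. cos (u * x)) = exp (- (u\<^sup>2) / 2)"
    by (simp add: char_std_normal_distribution)
  with int have "has_bochner_integral lborel (\<lambda>x. std_normal_density x * cos (u * x)) (exp (- (u\<^sup>2) / 2))"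
    by (simp add: has_bochner_integral_iff integrable_density integral_density)
  then have "has_bochner_integral lborel (\<lambda>y. std_normal_density (0 + \<sigma> * y) * cos (u * (0 + \<sigma> * y))) (exp (- (u\<^sup>2) / 2) /\<^sub>R \<bar>\<sigma>\<bar>)"
    using lborel_has_bochner_integral_real_affine_iff[of \<sigma> "\<lambda>x. std_normal_density x * cos (u * x)" _ 0] \<sigma> by blast
  note scaled = this
  have "((\<lambda>y. std_normal_density (0 + \<sigma> * y) * cos (u * (0 + \<sigma> * y))) has_integral (exp (- (u\<^sup>2) / 2) /\<^sub>R \<bar>\<sigma>\<bar>)) UNIV"
    using has_integral_integral_lborel[OF integrable.intros[OF scaled]]
    by (simp only: has_bochner_integral_integral_eq[OF scaled])
  from has_integral_mult_right[OF this, of "sqrt (2 * pi)"]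
  have "((\<lambda>y. sqrt (2 * pi) * (std_normal_density (0 + \<sigma> * y) * cos (u * (0 + \<sigma> * y)))) has_integral
     sqrt (2 * pi) * (exp (- (u\<^sup>2) / 2) /\<^sub>R \<bar>\<sigma>\<bar>)) UNIV" .
  moreover have "sqrt (2 * pi) * (exp (- (u\<^sup>2) / 2) /\<^sub>R \<bar>\<sigma>\<bar>) = exp (- (pi / t) * k\<^sup>2) / sqrt t"
  proof -
    have "u\<^sup>2 / 2 = pi / t * k\<^sup>2"
      using t by (simp add: u_def power_divide \<sigma>(2) power_mult_distrib) (simp add: power2_eq_square)
    moreover have "\<sigma> = sqrt (2 * pi) * sqrt t" by (simp add: \<sigma>_def real_sqrt_mult)
    ultimately show ?thesis using \<sigma>(1) by (simp add: field_simps)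
  qed
  moreover have "sqrt (2 * pi) * (std_normal_density (0 + \<sigma> * y) * cos (u * (0 + \<sigma> * y))) =
     exp (- (pi * t) * y\<^sup>2) * cos (2 * pi * k * y)" for y
  proof -
    have "(\<sigma> * y)\<^sup>2 / 2 = pi * t * y\<^sup>2" by (simp add: power_mult_distrib \<sigma>(2))
    moreover have u: "u * (\<sigma> * y) = 2 * pi * k * y" using \<sigma>(1) by (simp add: u_def)
    ultimately show ?thesis by (simp only: add_0 u std_normal_density_def) simp
  qed
  ultimately show ?thesis by simp
qed

text \<open>The integrals over [-N, N] have both numbers as limits: they are partial sums over a
  cofinal sequence of finite index sets, and also truncations of the integral over the line.\<close>

lemma has_sum_integrals_unit_intervals:
  fixes h :: "real \<Rightarrow> real"
  assumes h: "(h has_integral c) UNIV"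
    and sum: "((\<lambda>n::int. integral {of_int n..of_int n + 1} h) has_sum J) UNIV"
  shows "J = c"
proof -
  define i where "i = (\<lambda>n::int. integral {of_int n..of_int n + 1} h)"
  have intble: "h integrable_on {a..b}" for a b
    using h has_integral_integrable integrable_on_subinterval subset_UNIV by metis
  have eq: "sum i {- int N..<int N} = integral {- real N..real N} h" for N
  proof (induction N)
    case (Suc N)
    have "{- int (Suc N)..<int (Suc N)} = insert (- int (Suc N)) (insert (int N) {- int N..<int N})"
      by auto
    then have "sum i {- int (Suc N)..<int (Suc N)} = i (- int (Suc N)) + (i (int N) + sum i {- int N..<int N})"
      by simp
    also have "\<dots> = integral {- real (Suc N)..- real N} h + (integral {real N..real (Suc N)} h + integral {- real N..real N} h)"
      by (simp only: Suc) (simp add: i_def add.commute)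
    also have "integral {real N..real (Suc N)} h + integral {- real N..real N} h = integral {- real N..real (Suc N)} h"
      using Henstock_Kurzweil_Integration.integral_combine[where a = "- real N" and c = "real N" and b = "real (Suc N)" and f = h] intble by simp
    also have "integral {- real (Suc N)..- real N} h + integral {- real N..real (Suc N)} h = integral {- real (Suc N)..real (Suc N)} h"
      using Henstock_Kurzweil_Integration.integral_combine[where a = "- real (Suc N)" and c = "- real N" and b = "real (Suc N)" and f = h] intble by simp
    finally show ?case .
  qed simp
  have "filterlim (\<lambda>N. {- int N..<int N}) (finite_subsets_at_top UNIV) sequentially"
    unfolding filterlim_iff
  proof (intro allI impI)
    fix P assume "eventually P (finite_subsets_at_top (UNIV :: int set))"
    then obtain X where X: "finite X" "\<And>Y. finite Y \<Longrightarrow> X \<subseteq> Y \<Longrightarrow> P Y"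
      by (auto simp: eventually_finite_subsets_at_top)
    \<comment> \<open>The sum bounds every |x| in \<open>X\<close>; the extra 1 is for the open
      upper end of \<open>{- int N..<int N}\<close>.\<close>
    define K where "K = (\<Sum>x\<in>X. nat \<bar>x\<bar>) + 1"
    have "X \<subseteq> {- int N..<int N}" if "N \<ge> K" for N
    proof
      fix x assume "x \<in> X"
      then have "nat \<bar>x\<bar> \<le> (\<Sum>x\<in>X. nat \<bar>x\<bar>)" using X(1) by (intro member_le_sum) auto
      then show "x \<in> {- int N..<int N}" using that by (auto simp: K_def)
    qed
    then show "\<forall>\<^sub>F N in sequentially. P {- int N..<int N}"
      using X(2) by (auto intro: eventually_sequentiallyI[of K])
  qed
  then have lim1: "(\<lambda>N. sum i {- int N..<int N}) \<longlonglongrightarrow> J"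
    using sum unfolding has_sum_def i_def by (rule filterlim_compose[rotated])
  have lim2: "(\<lambda>N. integral {- real N..real N} h) \<longlonglongrightarrow> c"
  proof (rule LIMSEQ_I)
    fix r :: real assume "r > 0"
    then obtain B where B: "B > 0" "\<And>a b. ball 0 B \<subseteq> cbox a b \<Longrightarrow> norm (integral (cbox a b) h - c) < r"
      using h unfolding has_integral_alt' by auto
    obtain K :: nat where K: "B \<le> real K" using real_arch_simple by blast
    have "norm (integral {- real N..real N} h - c) < r" if "N \<ge> K" for N
      using B(2)[of "- real N" "real N"] K that by (force simp: ball_def dist_real_def)
    then show "\<exists>no. \<forall>N\<ge>no. norm (integral {- real N..real N} h - c) < r" by blast
  qed
  show ?thesis
    using LIMSEQ_unique[OF lim1] lim2 by (simp add: eq)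
qed

text \<open>Unfolding: the cosine has period 1, so integrating the translates of the Gaussian over
  [0, 1] gives the integral over the whole line cut into unit intervals.\<close>

lemma
  assumes t: "t > 0"
  shows theta_continuous_on: "continuous_on {0..1} (theta 1 (pi * t))"
    and theta_has_integral_cos: "((\<lambda>y. theta 1 (pi * t) y * cos (2 * pi * of_int k * y)) has_integral
       exp (- (pi / t) * (of_int k)\<^sup>2) / sqrt t) {0..1}"
proof -
  define s where "s = pi * t"
  have s: "s > 0" using t by (simp add: s_def)
  define h where "h = (\<lambda>k y. exp (- s * y\<^sup>2) * cos (2 * pi * of_int k * y))" 
  \<comment> \<open>For y in [0, 1] the distance |n + y| is least at an endpoint, 0 if n \<ge> 0 and
    1 otherwise; adding both endpoint values avoids the case distinction.\<close>
  define M where "M = (\<lambda>n::int. exp (- s * (of_int n + 0)\<^sup>2) + exp (- s * (of_int n + 1)\<^sup>2))"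
  define f where "f = (\<lambda>(k::int) (n::int) y. exp (- s * (of_int n + y)\<^sup>2) * cos (2 * pi * of_int k * y))"
  have f_h: "f k n = h k \<circ> (+) (of_int n)" for k n
  proof
    fix y
    have "cos (2 * pi * of_int k * (of_int n + y)) = cos (2 * pi * of_int (k * n) + 2 * pi * of_int k * y)"
      by (simp add: algebra_simps)
    also have "\<dots> = cos (2 * pi * of_int k * y)"
      by (simp only: cos_add cos_int_2pin sin_int_2pin mult_1 mult_zero_left diff_zero)
    finally show "f k n y = (h k \<circ> (+) (of_int n)) y"
      by (simp add: f_def h_def)
  qed
  have cont: "continuous_on {0..1} (f k n)" for k n
    unfolding f_def by (intro continuous_intros)
  have bound: "\<bar>f k n y\<bar> \<le> M n" if "y \<in> {0..1}" for k n y
  proof -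
    have "(of_int n + 0)\<^sup>2 \<le> (of_int n + y)\<^sup>2 \<or> (of_int n + 1)\<^sup>2 \<le> (of_int n + y)\<^sup>2"
    proof (cases "n \<ge> 0")
      case True
      then show ?thesis using that by (intro disjI1 power_mono) auto
    next
      case False
      then have "of_int n \<le> (-1 :: real)" by linarith
      then have "\<bar>of_int n + 1\<bar> \<le> \<bar>of_int n + y\<bar>" using that by auto
      then show ?thesis by (simp add: abs_le_square_iff)
    qed
    then have "exp (- s * (of_int n + y)\<^sup>2) \<le> exp (- s * (of_int n + 0)\<^sup>2) \<or>
        exp (- s * (of_int n + y)\<^sup>2) \<le> exp (- s * (of_int n + 1)\<^sup>2)"
      using s by auto
    then have "exp (- s * (of_int n + y)\<^sup>2) \<le> M n"
      unfolding M_def by (meson add_increasing add_increasing2 exp_ge_zero)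
    moreover have "\<bar>f k n y\<bar> \<le> exp (- s * (of_int n + y)\<^sup>2) * 1"
      unfolding f_def abs_mult by (intro mult_mono) auto
    ultimately show ?thesis by simp
  qed
  have M: "M summable_on UNIV"
    unfolding M_def by (intro summable_on_add summable_on_gauss s)
  have int: "(f k n has_integral integral {of_int n..of_int n + 1} (h k)) {0..1}" for k n
  proof -
    have "h k integrable_on {of_int n..of_int n + 1}"
      unfolding h_def by (intro integrable_continuous_interval continuous_intros)
    then show ?thesis
      unfolding f_h has_integral_shift_Icc_real by (simp add: add.commute integrable_integral)
  qed
  have theta_f: "(\<Sum>\<^sub>\<infinity>n. f k n y) = theta 1 s y * cos (2 * pi * of_int k * y)" for k y
    by (simp add: f_def theta_def infsum_cmult_left')
  have sums: "continuous_on {0..1} (\<lambda>y. \<Sum>\<^sub>\<infinity>n. f k n y)"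
    "\<exists>J. ((\<lambda>n. integral {of_int n..of_int n + 1} (h k)) has_sum J) UNIV \<and>
       ((\<lambda>y. \<Sum>\<^sub>\<infinity>n. f k n y) has_integral J) {0..1}" for k
    using has_integral_infsum_uniform[OF cont bound M int] by auto
  show "continuous_on {0..1} (theta 1 (pi * t))"
    using sums(1)[of 0] by (simp add: theta_f s_def)
  obtain J where J: "((\<lambda>n. integral {of_int n..of_int n + 1} (h k)) has_sum J) UNIV"
     "((\<lambda>y. \<Sum>\<^sub>\<infinity>n. f k n y) has_integral J) {0..1}"
    using sums(2)[of k] by blast
  have "(h k has_integral exp (- (pi / t) * (of_int k)\<^sup>2) / sqrt t) UNIV"
    using has_integral_gauss_cos[OF t, of "of_int k"] by (simp add: h_def s_def)
  from has_sum_integrals_unit_intervals[OF this J(1)] J(2)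
  show "((\<lambda>y. theta 1 (pi * t) y * cos (2 * pi * of_int k * y)) has_integral
       exp (- (pi / t) * (of_int k)\<^sup>2) / sqrt t) {0..1}"
    by (simp add: theta_f s_def)
qed

text \<open>Both sides are continuous, symmetric under x to 1 - x, and have the same cosine
  coefficients: unfolding gives those of theta, orthogonality those of the series. Uniqueness of the
  coefficients then gives equality at every point.\<close>

lemma theta_inversion:
  assumes t: "t > 0" and x: "x \<in> {0..1}"
  shows "theta 1 (pi * t) x = (\<Sum>\<^sub>\<infinity>n::int. exp (- (pi / t) * (of_int n)\<^sup>2) * cos (2 * pi * of_int n * x)) / sqrt t"
proof -
  define c where "c = (\<lambda>n::int. exp (- (pi / t) * (of_int n)\<^sup>2) / sqrt t)"
  define f where "f = (\<lambda>k (n::int) x. c n * (cos (2 * pi * of_int n * x) * cos (2 * pi * of_int k * x)))" 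
  have c_pos: "c n \<ge> 0" for n using t by (simp add: c_def)
  have c_sum: "c summable_on UNIV"
    using summable_on_cmult_left'[of "1 / sqrt t" "\<lambda>n::int. exp (- (pi / t) * (of_int n + 0)\<^sup>2)" UNIV]
      summable_on_gauss[of "pi / t" 0] t by (simp add: c_def)
  have cont: "continuous_on {0..1} (f k n)" for k n
    unfolding f_def by (intro continuous_intros)
  have bound: "\<bar>f k n y\<bar> \<le> c n" for k n y
  proof -
    have "\<bar>f k n y\<bar> \<le> c n * (1 * 1)"
      unfolding f_def abs_mult using c_pos[of n] by (intro mult_mono) auto
    then show ?thesis by simp
  qed
  have int: "(f k n has_integral c n * (((if n = - k then 1 else 0) + (if n = k then 1 else 0)) / 2)) {0..1}" for k n
    unfolding f_def by (intro has_integral_mult_right has_integral_cos_mult_cos)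
  define G where "G = (\<lambda>x. \<Sum>\<^sub>\<infinity>n. c n * cos (2 * pi * of_int n * x))"
  have G_f: "(\<Sum>\<^sub>\<infinity>n. f k n y) = G y * cos (2 * pi * of_int k * y)" for k y
    by (simp add: f_def G_def infsum_cmult_left' flip: mult.assoc)
  have sums: "continuous_on {0..1} (\<lambda>y. \<Sum>\<^sub>\<infinity>n. f k n y)"
    "\<exists>J. ((\<lambda>n. c n * (((if n = - k then 1 else 0) + (if n = k then 1 else 0)) / 2)) has_sum J) UNIV \<and>
       ((\<lambda>y. \<Sum>\<^sub>\<infinity>n. f k n y) has_integral J) {0..1}" for k
    using has_integral_infsum_uniform[OF cont bound c_sum int] by auto
  have cont_G: "continuous_on {0..1} G"
    using sums(1)[of 0] by (simp add: G_f)
  have coeff_G: "((\<lambda>x. G x * cos (2 * pi * of_int k * x)) has_integral c k) {0..1}" for k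
  proof -
    obtain J where J: "((\<lambda>n. c n * (((if n = - k then 1 else 0) + (if n = k then 1 else 0)) / 2)) has_sum J) UNIV"
      "((\<lambda>x. G x * cos (2 * pi * of_int k * x)) has_integral J) {0..1}"
      using sums(2)[of k] by (auto simp: G_f)
    \<comment> \<open>For k = 0 both indicators meet in one index with total weight 1; otherwise
      \<open>c\<close> is even and two halves add up.\<close>
    have "((\<lambda>n. c n * (((if n = - k then 1 else 0) + (if n = k then 1 else 0)) / 2)) has_sum c k) UNIV"
      by (rule has_sum_finite_neutralI[of "{k, - k}"]) (cases "k = 0"; simp add: c_def)+
    with J show ?thesis using has_sum_unique by blast
  qed
  define D where "D = (\<lambda>x. theta 1 (pi * t) x - G x)"
  have "D x = 0"
  proof (rule even_periodic_eq_0[OF _ _ _ x])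
    show "continuous_on {0..1} D"
      unfolding D_def by (intro continuous_intros theta_continuous_on[OF t] cont_G)
    show "D (1 - x) = D x" for x
    proof -
      have "theta 1 (pi * t) (1 - x) = theta 1 (pi * t) x"
        using theta_shift[of "pi * t" 1 "- x"] theta_uminus[of "pi * t" 1 x] t by simp
      moreover have "cos (2 * pi * of_int n * (1 - x)) = cos (2 * pi * of_int n * x)" for n
      proof -
        have "cos (2 * pi * of_int n * (1 - x)) = cos (2 * pi * of_int n - 2 * pi * of_int n * x)"
          by (simp add: algebra_simps)
        also have "\<dots> = cos (2 * pi * of_int n * x)"
          by (simp only: cos_diff cos_int_2pin sin_int_2pin mult_1 mult_zero_left add_0_right)
        finally show ?thesis .
      qed
      ultimately show ?thesis by (simp only: D_def G_def)
    qed
    show "((\<lambda>x. D x * cos (2 * pi * of_int k * x)) has_integral 0) {0..1}" for k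
      using has_integral_diff[OF theta_has_integral_cos[OF t, of k] coeff_G[of k]]
      by (simp add: D_def c_def left_diff_distrib)
  qed
  moreover have "G x = (\<Sum>\<^sub>\<infinity>n::int. exp (- (pi / t) * (of_int n)\<^sup>2) * cos (2 * pi * of_int n * x)) * (1 / sqrt t)"
    unfolding G_def c_def by (subst infsum_cmult_left'[symmetric]) (simp add: mult_ac)
  ultimately show ?thesis by (simp add: D_def)
qed

lemma theta3_inversion:
  assumes t: "t > 0"
  shows "theta3 (pi * t) = theta3 (pi / t) / sqrt t"
  using theta_inversion[OF t, of 0] by (simp add: theta_def)

lemma theta2_inversion:
  assumes t: "t > 0"
  shows "theta2 (pi * t) = theta4 (pi / t) / sqrt t"
proof -
  have "cos (2 * pi * of_int n * (1/2)) = (-1) powi n" for n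
    by (simp add: power_int_minus_left cos_npi_int)
  then show ?thesis
    using theta_inversion[OF t, of "1/2"] by (simp only: theta_def) (simp add: mult.commute)
qed

lemma theta4_inversion:
  assumes t: "t > 0"
  shows "theta4 (pi * t) = theta2 (pi / t) / sqrt t"
  using theta2_inversion[of "1 / t"] t by (simp add: real_sqrt_divide)

section \<open>The elliptic modulus\<close>

definition modulus :: "real \<Rightarrow> real" where
  "modulus s = (theta2 s / theta3 s)\<^sup>2"

definition comodulus :: "real \<Rightarrow> real" where
  "comodulus s = (theta4 s / theta3 s)\<^sup>2"

lemma modulus_pos: "s > 0 \<Longrightarrow> modulus s > 0"
  using theta_pos[of s 0] theta_pos[of s "1/2"] by (simp add: modulus_def)

lemma comodulus_pos: "s > 0 \<Longrightarrow> comodulus s > 0"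
  using theta_pos[of s 0] theta4_pos[of s] by (simp add: comodulus_def)

lemma modulus_comodulus:
  assumes "s > 0"
  shows "(modulus s)\<^sup>2 + (comodulus s)\<^sup>2 = 1"
proof -
  have "(modulus s)\<^sup>2 + (comodulus s)\<^sup>2 = (theta2 s ^ 4 + theta4 s ^ 4) / theta3 s ^ 4"
    by (simp add: modulus_def comodulus_def power_divide add_divide_distrib)
  also have "\<dots> = 1"
    using theta_pos[OF assms, of 0] by (simp flip: theta_quartic[OF assms])
  finally show ?thesis .
qed

text \<open>Landen's transformation: half the sum and half the difference of the squares of
  \<open>theta3\<close> and \<open>theta4\<close> at s are the squares of \<open>theta3\<close> and
  \<open>theta2\<close> at 2 s.\<close>

lemma modulus_double:
  assumes "s > 0"
  shows "modulus (2 * s) = (1 - comodulus s) / (1 + comodulus s)"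
proof -
  have 2: "2 * (theta2 (2 * s))\<^sup>2 = (theta3 s)\<^sup>2 - (theta4 s)\<^sup>2"
    and 3: "2 * (theta3 (2 * s))\<^sup>2 = (theta3 s)\<^sup>2 + (theta4 s)\<^sup>2"
    using theta3_square[OF assms] theta4_square[OF assms] by simp_all
  have t: "(theta3 s)\<^sup>2 > 0" using theta_pos[OF assms, of 0] by simp
  have "modulus (2 * s) = (2 * (theta2 (2 * s))\<^sup>2) / (2 * (theta3 (2 * s))\<^sup>2)"
    by (simp add: modulus_def power_divide)
  also have "\<dots> = ((theta3 s)\<^sup>2 - (theta4 s)\<^sup>2) / ((theta3 s)\<^sup>2 + (theta4 s)\<^sup>2)"
    by (simp only: 2 3)
  also have "\<dots> = (((theta3 s)\<^sup>2 - (theta4 s)\<^sup>2) / (theta3 s)\<^sup>2) / (((theta3 s)\<^sup>2 + (theta4 s)\<^sup>2) / (theta3 s)\<^sup>2)"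
    using t by simp
  also have "\<dots> = (1 - comodulus s) / (1 + comodulus s)"
    using t by (simp add: comodulus_def power_divide diff_divide_distrib add_divide_distrib)
  finally show ?thesis .
qed

lemma comodulus_inversion:
  assumes "t > 0"
  shows "comodulus (pi * t) = modulus (pi / t)"
  using assms by (simp add: modulus_def comodulus_def theta4_inversion theta3_inversion)

text \<open>Legendre's modular equation of degree 3: \<open>theta_cubic\<close> divided by its left
  side.\<close>

lemma modulus_cubic:
  assumes s: "s > 0"
  shows "sqrt (modulus s * modulus (3 * s)) + sqrt (comodulus s * comodulus (3 * s)) = 1"
proof -
  have s3: "3 * s > 0" using s by simp
  note pos = theta_pos[OF s, of 0] theta_pos[OF s3, of 0] theta_pos[OF s, of "1/2"] theta_pos[OF s3, of "1/2"]
    theta4_pos[OF s] theta4_pos[OF s3]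
  have "sqrt (modulus s * modulus (3 * s)) = (theta2 s * theta2 (3 * s)) / (theta3 s * theta3 (3 * s))"
    using pos by (simp add: modulus_def real_sqrt_mult)
  moreover have "sqrt (comodulus s * comodulus (3 * s)) = (theta4 s * theta4 (3 * s)) / (theta3 s * theta3 (3 * s))"
    using pos by (simp add: comodulus_def real_sqrt_mult)
  moreover have "theta2 s * theta2 (3 * s) + theta4 s * theta4 (3 * s) = theta3 s * theta3 (3 * s)"
    using theta_cubic[OF s] by simp
  ultimately show ?thesis
    using pos by (simp flip: add_divide_distrib)
qed

lemma modulus_tendsto: "((\<lambda>s. modulus s * exp (s / 2)) \<longlongrightarrow> 4) at_top"
proof -
  have "((\<lambda>s. ((theta2 s * exp (s / 4)) / (theta3 s * exp (s * 0\<^sup>2)))\<^sup>2) \<longlongrightarrow> (2 / 1)\<^sup>2) at_top"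
    by (intro tendsto_power tendsto_divide theta2_tendsto theta_tendsto) auto
  then show ?thesis
    by (simp add: modulus_def power_divide power_mult_distrib flip: exp_double)
qed

text \<open>Landen's transformation preserves the order of two moduli, so that the order can be read off
  from their asymptotics along \<open>2 ^ n * s\<close>.\<close>

lemma modulus_strict_antimono:
  assumes r: "r > 0" and rs: "r < s"
  shows "modulus s < modulus r"
proof (rule ccontr)
  assume "\<not> modulus s < modulus r"
  then have 0: "modulus r \<le> modulus s" by simp
  have s: "s > 0" using r rs by simp
  have step: "modulus (2 * a) \<le> modulus (2 * b)" if "a > 0" "b > 0" "modulus a \<le> modulus b" for a b
  proof -
    have "(modulus a)\<^sup>2 \<le> (modulus b)\<^sup>2"
      using that modulus_pos[of a] by (intro power_mono) auto
    then have "(comodulus b)\<^sup>2 \<le> (comodulus a)\<^sup>2"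
      using modulus_comodulus[of a] modulus_comodulus[of b] that by linarith
    then have "comodulus b \<le> comodulus a"
      by (rule power2_le_imp_le) (use comodulus_pos[of a] that in simp)
    then show ?thesis
      using comodulus_pos[of a] comodulus_pos[of b] that
      by (simp add: modulus_double divide_simps) (simp add: algebra_simps)
  qed
  have le: "modulus (2 ^ n * r) \<le> modulus (2 ^ n * s)" for n
  proof (induction n)
    case (Suc n)
    then show ?case using step[of "2 ^ n * r" "2 ^ n * s"] r s by (simp add: mult.assoc)
  qed (use 0 in simp)
  \<comment> \<open>Normalised so that the limit is 4 for every s. Under the assumed order the
    sequence for r is at most the one for s times exp (- 2^n (s - r) / 2), which would force 4 \<le>
    0.\<close>
  define A where "A = (\<lambda>s n. modulus (2 ^ n * s) * exp (2 ^ n * s / 2))" 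
  have lim: "A s \<longlonglongrightarrow> 4" if "s > 0" for s
  proof -
    have "filterlim (\<lambda>n::nat. 2 ^ n * s) at_top sequentially" using that by real_asymp
    from filterlim_compose[OF modulus_tendsto this] show ?thesis by (simp add: A_def)
  qed
  have "(\<lambda>n::nat. exp (- (2 ^ n * (s - r) / 2))) \<longlonglongrightarrow> 0"
    using rs by real_asymp
  with tendsto_mult[OF this lim[OF s]]
  have lim0: "(\<lambda>n. exp (- (2 ^ n * (s - r) / 2)) * A s n) \<longlonglongrightarrow> 0" by simp
  have "A r n \<le> exp (- (2 ^ n * (s - r) / 2)) * A s n" for n
  proof -
    have "exp (- (2 ^ n * (s - r) / 2)) * exp (2 ^ n * s / 2) = exp (2 ^ n * r / 2)"
      by (simp add: field_simps flip: exp_add)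
    then have A: "exp (- (2 ^ n * (s - r) / 2)) * A s n = modulus (2 ^ n * s) * exp (2 ^ n * r / 2)"
      by (simp add: A_def)
    show ?thesis unfolding A using le[of n] by (simp add: A_def)
  qed
  then have "4 \<le> (0::real)"
    by (intro LIMSEQ_le[OF lim[OF r] lim0]) auto
  then show False by simp
qed

lemma theta_antimono:
  assumes "r > 0" "r \<le> s"
  shows "theta 1 s a \<le> theta 1 r a"
  by (rule has_sum_mono[OF has_sum_theta has_sum_theta]) (use assms in \<open>auto intro: mult_right_mono\<close>)

section \<open>From h' to the complementary modulus\<close>

lemma phi_minus_exp:
  assumes "s > 0"
  shows "phi (- exp (- s)) = theta4 s"
  unfolding phi_def theta_def
proof (rule infsum_cong)
  fix m :: int
  have "(- exp (- s)) ^ nat (m\<^sup>2) = (-1) ^ nat (m\<^sup>2) * exp (- s) ^ nat (m\<^sup>2)"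
    by (rule power_minus)
  also have "exp (- s) ^ nat (m\<^sup>2) = exp (- s * (of_int m + 0)\<^sup>2)"
    by (simp add: mult.commute flip: exp_of_nat_mult)
  also have "(-1) ^ nat (m\<^sup>2) = (-1 :: real) powi m"
    by (simp add: power_int_minus_left minus_one_power_iff even_nat_iff)
  finally show "(- exp (- s)) ^ nat (m\<^sup>2) = (-1) powi m * exp (- s * (of_int m + 0)\<^sup>2)" .
qed

lemma h'_2_eq:
  assumes n: "n > 0"
  shows "h' 2 n = ((comodulus (pi * sqrt (2 * n)))\<^sup>2 / 4) powr (1/8)"
proof -
  define s where "s = pi * sqrt (2 * n)"
  have s: "s > 0" "2 * s > 0" using n by (simp_all add: s_def)
  note pos = theta_pos[OF s(1), of 0] theta4_pos[OF s(1)] theta4_pos[OF s(2)]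
  have "sqrt (2 * n) = sqrt (4 * (n / 2))" by simp
  also have "\<dots> = 2 * sqrt (n / 2)" by (subst real_sqrt_mult) simp
  finally have q: "exp (- 2 * pi * sqrt (n / 2)) = exp (- s)" by (simp add: s_def)
  have "exp (- s) powr 2 = exp (- (2 * s))" by (simp add: powr_def)
  then have h: "h' 2 n = theta4 s / (2 powr (1/4) * theta4 (2 * s))"
    unfolding h'_def Let_def q using phi_minus_exp[OF s(1)] phi_minus_exp[OF s(2)] by simp
  have "(2 powr (1/4)) ^ 8 = (4::real)"
    by (simp flip: powr_realpow add: powr_powr)
  \<comment> \<open>Grouping the eighth power of \<open>theta4 (2 * s)\<close> into squares lets
    \<open>theta3_theta4\<close> return to s; half of the numerator then cancels.\<close>
  then have "(h' 2 n) ^ 8 = (theta4 s) ^ 8 / (4 * ((theta4 (2 * s))\<^sup>2) ^ 4)"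
    by (simp add: h power_divide power_mult_distrib flip: power_mult)
  also have "\<dots> = (theta4 s) ^ 8 / (4 * (theta3 s * theta4 s) ^ 4)"
    by (simp only: theta3_theta4[OF s(1)])
  also have "\<dots> = (comodulus s)\<^sup>2 / 4"
    using pos by (simp add: comodulus_def power_divide power_mult_distrib flip: power_mult)
       (simp add: field_simps flip: power_add)
  finally have h8: "(h' 2 n) ^ 8 = (comodulus s)\<^sup>2 / 4" .
  have "h' 2 n > 0" using pos by (simp add: h)
  then have "h' 2 n = (h' 2 n powr 8) powr (1/8)" by (simp only: powr_powr) simp
  also have "h' 2 n powr 8 = (h' 2 n) ^ 8" using \<open>h' 2 n > 0\<close> by simp
  finally show ?thesis by (simp only: h8 s_def)
qed

lemma h'_2_eqI:
  assumes n: "n > 0" and X: "(comodulus (pi * sqrt (2 * n)))\<^sup>2 = 2 * X"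
  shows "h' 2 n = 2 powr (-1/8) * X powr (1/8)"
proof -
  have "h' 2 n = (inverse 2 * X) powr (1/8)"
    using h'_2_eq[OF n] X by simp
  also have "\<dots> = (inverse 2) powr (1/8) * X powr (1/8)"
    by (rule powr_mult)
  also have "inverse 2 powr (1/8) = (2::real) powr (-1/8)"
    by (simp add: powr_divide powr_minus_divide)
  finally show ?thesis .
qed

section \<open>Singular moduli\<close>

text \<open>For s = pi / sqrt 2, inversion and doubling lead to the same point, so Landen's
  transformation becomes a quadratic equation for x.\<close>

lemma modulus_2: "modulus (pi * sqrt 2) = sqrt 2 - 1"
proof -
  define x where "x = modulus (pi * sqrt 2)"
  have x: "x > 0" by (simp add: x_def modulus_pos)
  have "comodulus (pi * (1 / sqrt 2)) = x"
    by (subst comodulus_inversion) (simp_all add: x_def)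
  moreover have "2 * (pi * (1 / sqrt 2)) = pi * sqrt 2"
    by (simp add: field_simps flip: power2_eq_square)
  ultimately have "x = (1 - x) / (1 + x)"
    using modulus_double[of "pi * (1 / sqrt 2)"] by (simp add: x_def)
  then have "(x + 1)\<^sup>2 = 2" using x by (simp add: field_simps power2_eq_square)
  then have "x + 1 = sqrt 2" using x by (intro real_sqrt_unique[symmetric]) auto
  then show ?thesis by (simp add: x_def)
qed

lemma comodulus_square: "s > 0 \<Longrightarrow> (comodulus s)\<^sup>2 = 1 - (modulus s)\<^sup>2"
  using modulus_comodulus[of s] by simp

lemma sqrt_6: "sqrt 6 = sqrt 2 * sqrt 3"
  by (simp flip: real_sqrt_mult)

lemma comodulus_2: "(comodulus (pi * sqrt 2))\<^sup>2 = 2 * (sqrt 2 - 1)"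
  by (subst comodulus_square) (simp_all add: modulus_2 power2_eq_square algebra_simps)

text \<open>With r = pi / sqrt 6, inversion makes \<open>comodulus r\<close> equal to
  \<open>x\<close>, doubling gives \<open>y\<close> at 2 r, and tripling returns to pi sqrt 6, where
  the cubic equation ties \<open>y\<close> to \<open>x\<close>.\<close>

lemma comodulus_6:
  "(comodulus (pi * sqrt 6))\<^sup>2 = 2 * (- 17 - 12 * sqrt 2 + 10 * sqrt 3 + 7 * sqrt 6)"
proof -
  define a b where "a = sqrt (2 :: real)" and "b = sqrt (3 :: real)"
  note ab = a_def b_def
  have q: "a\<^sup>2 = 2" "b\<^sup>2 = 3" and ab_pos: "a > 0" "b > 0" by (simp_all add: ab)
  have sq: "a * a = 2" "a * (a * z) = 2 * z" "b * b = 3" "b * (b * z) = 3 * z" for z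
    using q by (simp_all add: power2_eq_square flip: mult.assoc)
  define r where "r = pi / sqrt 6"
  define x where "x = modulus (pi * sqrt 6)"
  define y where "y = modulus (2 * r)"
  define A where "A = sqrt (x * y)"
  define B where "B = sqrt (comodulus (pi * sqrt 6) * comodulus (2 * r))"
  have r: "r > 0" by (simp add: r_def)
  have s: "pi * sqrt 6 = 3 * (2 * r)" by (simp add: r_def field_simps)
  have x: "x > 0" "y > 0" "x < y"
    using modulus_strict_antimono[of "2 * r" "pi * sqrt 6"] r by (simp_all add: x_def y_def modulus_pos s)
  have "comodulus r = x"
    using comodulus_inversion[of "1 / sqrt 6"] by (simp add: r_def x_def)
  then have y: "y = (1 - x) / (1 + x)"
    using modulus_double[OF r] by (simp add: y_def)
  have y1: "y * (1 + x) = 1 - x" using x by (simp add: y)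
  have AB: "A + B = 1"
    using modulus_cubic[of "2 * r"] r by (simp add: A_def B_def x_def y_def s mult.commute)
  have A2: "A\<^sup>2 = x * y" and A0: "A > 0" using x by (simp_all add: A_def)
  have B0: "B > 0"
    using comodulus_pos[of "pi * sqrt 6"] comodulus_pos[of "2 * r"] r by (simp add: B_def)
  have "B ^ 4 = (B\<^sup>2)\<^sup>2" by simp
  also have "\<dots> = (comodulus (pi * sqrt 6))\<^sup>2 * (comodulus (2 * r))\<^sup>2"
    using comodulus_pos[of "pi * sqrt 6"] comodulus_pos[of "2 * r"] r by (simp add: B_def power_mult_distrib)
  also have "\<dots> = (1 - x\<^sup>2) * (1 - y\<^sup>2)"
    using r by (simp add: comodulus_square x_def y_def)
  \<comment> \<open>Landen's relation makes the fourth power of \<open>B\<close> a function of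
    \<open>A\<close> alone. With A + B = 1 this leaves (1 - A)^2 = 2 A, that is (2 - A)^2 =
    3.\<close>
  also have "\<dots> = 4 * (x * y)" using y1 by algebra
  also have "\<dots> = (2 * A)\<^sup>2" by (simp add: A2 power_mult_distrib)
  finally have "(B\<^sup>2)\<^sup>2 = (2 * A)\<^sup>2" by simp
  then have "B\<^sup>2 = 2 * A" by (rule power2_eq_imp_eq) (use A0 in auto)
  then have "(2 - A)\<^sup>2 = (b)\<^sup>2" using AB q by algebra
  then have "2 - A = b" by (rule power2_eq_imp_eq) (use AB B0 ab_pos in auto)
  then have A: "A = 2 - b" by simp
  \<comment> \<open>\<open>x\<close> and \<open>y\<close> have product A^2 and, by
    \<open>y1\<close>, sum 1 - A^2. \<open>p\<close> and \<open>p'\<close> are the roots of that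
    quadratic, and x < y selects the smaller one.\<close>
  define p where "p = (2 - b) * (b - a)"
  define p' where "p' = (2 - b) * (b + a)"
  have p: "p * p' = A\<^sup>2" unfolding p_def p'_def A by (simp add: power2_eq_square algebra_simps sq)
  have p2: "p + p' = 1 - A\<^sup>2" unfolding p_def p'_def A by (simp add: power2_eq_square algebra_simps sq)
  have "(x - p) * (x - p') = 0"
    using p p2 y1 A2 by algebra
  moreover have "x \<noteq> p'"
  proof
    assume xp: "x = p'"
    then have "p' * p = p' * y" using p A2 by (simp add: mult.commute)
    then have "p = y" using x xp by simp
    moreover have "p \<le> p'" unfolding p_def p'_def
      using real_sqrt_le_mono[of 3 4] ab_pos by (intro mult_left_mono) (auto simp: b_def)
    ultimately show False using x xp by simp
  qed
  ultimately have xp: "x = p" by simp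
  have "1 - x\<^sup>2 = 2 * (- 17 - 12 * a + 10 * b + 7 * (a * b))"
    unfolding xp p_def by (simp add: power2_eq_square algebra_simps sq)
  then show ?thesis by (simp add: comodulus_square sqrt_6 x_def ab)
qed

text \<open>In \<open>theta_quintic\<close> at s = 2 pi / sqrt 10, inversion turns both
  \<open>theta4\<close> values into the two \<open>theta2\<close> values, so only \<open>P\<close>
  and \<open>Q\<close> remain, in a homogeneous quadratic equation.\<close>

lemma comodulus_10:
  "(comodulus (pi * sqrt 10))\<^sup>2 = 2 * (- 161 - 72 * sqrt 5 + 51 * sqrt 10 + 114 * sqrt 2)"
proof -
  define a f where "a = sqrt (2 :: real)" and "f = sqrt (5 :: real)"
  note af = a_def f_def
  have q: "a\<^sup>2 = 2" "f\<^sup>2 = 5" and af_pos: "a > 0" "f > 0" by (simp_all add: af)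
  have sq: "a * a = 2" "a * (a * z) = 2 * z" "f * f = 5" "f * (f * z) = 5 * z" for z
    using q by (simp_all add: power2_eq_square flip: mult.assoc)
  define w where "w = sqrt (10 :: real)"
  define P where "P = (theta2 (pi / w))\<^sup>2"
  define Q where "Q = (theta2 (pi * w / 2))\<^sup>2"
  have w: "w > 0" "w\<^sup>2 = 10" by (simp_all add: w_def)
  have w2: "2 / w = w / 5" "pi / (2 / w) = pi * w / 2" using w by (simp_all add: field_simps power2_eq_square)
  have Q0: "Q > 0" using theta_pos[of "pi * w / 2" "1/2"] w by (simp add: Q_def)
  have QP: "Q \<le> P"
    unfolding P_def Q_def
  proof (rule power_mono)
    show "theta2 (pi * w / 2) \<le> theta2 (pi / w)"
      by (rule theta_antimono) (use w in \<open>simp_all add: field_simps flip: power2_eq_square\<close>)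
    show "0 \<le> theta2 (pi * w / 2)" using theta_pos[of "pi * w / 2" "1/2"] w by simp
  qed
  have inv1: "(theta4 (pi * w))\<^sup>2 = P / w"
    using theta4_inversion[OF w(1)] w by (simp add: P_def power_divide)
  have inv2: "(theta4 (pi * (2 / w)))\<^sup>2 = Q * w / 2"
    using theta4_inversion[of "2 / w"] w by (simp add: w2(2) Q_def power_divide)
  have s: "pi * (2 / w) > 0" "pi * (2 / w) / 2 = pi / w" "5 * (pi * (2 / w)) / 2 = pi * w / 2"
    "5 * (pi * (2 / w)) = pi * w"
    using w by (simp_all add: field_simps flip: power2_eq_square)
  have "(P - Q) * (P / w - Q * w / 2) = 4 * (P / w) * Q"
    using theta_quintic[OF s(1)] unfolding s inv1 inv2 P_def[symmetric] Q_def[symmetric] .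
  then have "(P - Q) * ((P / w - Q * w / 2) * w) = 4 * (P / w * w) * Q"
    by (metis mult.assoc mult.commute)
  moreover have "(P / w - Q * w / 2) * w = P - Q * w\<^sup>2 / 2" "P / w * w = P"
    using w(1) by (simp_all add: left_diff_distrib power2_eq_square)
  ultimately have "(P - Q) * (P - Q * w\<^sup>2 / 2) = 4 * P * Q" by (simp only:)
  \<comment> \<open>The form is P^2 - 10 P Q + 5 Q^2, with ratios 5 +- 2 sqrt 5; the smaller ratio
    is below 1 and contradicts Q \<le> P.\<close>
  moreover have "(P - Q) * (P - Q * w\<^sup>2 / 2) - 4 * P * Q = (P - (5 + 2 * f) * Q) * (P - (5 - 2 * f) * Q)"
    by (simp add: w(2) algebra_simps sq)
  ultimately have "(P - (5 + 2 * f) * Q) * (P - (5 - 2 * f) * Q) = 0" by simp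
  moreover have "P \<noteq> (5 - 2 * f) * Q"
  proof -
    have "f > 2" unfolding f_def by (rule real_less_rsqrt) simp
    then have "(5 - 2 * f) * Q < 1 * Q" using Q0 by (intro mult_strict_right_mono) auto
    then show ?thesis using QP by simp
  qed
  ultimately have P: "P = (5 + 2 * f) * Q" by simp
  define k where "k = modulus (pi * w)"
  define c where "c = comodulus (pi * w)"
  have pw: "pi * w > 0" using w by simp
  \<comment> \<open>Duplication brings \<open>Q\<close> from pi w / 2 to pi w, so that
    \<open>c\<close> becomes a multiple of sqrt k.\<close>
  have Q': "Q = 2 * theta2 (pi * w) * theta3 (pi * w)"
    using theta2_square[of "pi * w / 2"] pw by (simp add: Q_def)
  have "c = (theta4 (pi * w))\<^sup>2 / (theta3 (pi * w))\<^sup>2"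
    by (simp add: c_def comodulus_def power_divide)
  also have "\<dots> = (10 + 4 * f) / w * (theta2 (pi * w) / theta3 (pi * w))"
    using theta_pos[OF pw, of 0] w(1) unfolding inv1 P Q'
    by (simp add: field_simps power2_eq_square)
  finally have "c\<^sup>2 = (10 + 4 * f)\<^sup>2 / w\<^sup>2 * k"
    by (simp add: k_def modulus_def power_mult_distrib power_divide)
  also have "(10 + 4 * f)\<^sup>2 / w\<^sup>2 = 18 + 8 * f"
    using w(2) q by (simp add: power2_eq_square algebra_simps)
  finally have c: "c\<^sup>2 = (18 + 8 * f) * k" .
  have k0: "k > 0" using modulus_pos[OF pw] by (simp add: k_def)
  have "k\<^sup>2 + c\<^sup>2 = 1" using modulus_comodulus[OF pw] by (simp add: k_def c_def)
  \<comment> \<open>Completing the square in k^2 + (18 + 8 f) k = 1; the constant 162 + 72 f happens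
    to be a square in the field of \<open>a\<close> and \<open>f\<close>.\<close>
  moreover have "(k + (9 + 4 * f))\<^sup>2 = k\<^sup>2 + (18 + 8 * f) * k + (161 + 72 * f)"
    "(3 * a * (2 + f))\<^sup>2 = 162 + 72 * f"
    by (simp_all add: power2_eq_square algebra_simps sq)
  ultimately have "(k + (9 + 4 * f))\<^sup>2 = (3 * a * (2 + f))\<^sup>2"
    using c by simp
  then have "k + (9 + 4 * f) = 3 * a * (2 + f)"
    by (rule power2_eq_imp_eq) (use k0 af_pos in auto)
  then have k: "k = 3 * a * (2 + f) - (9 + 4 * f)" by simp
  have "sqrt 10 = a * f" by (simp add: af flip: real_sqrt_mult)
  moreover have "c\<^sup>2 = 2 * (- 161 - 72 * f + 51 * (a * f) + 114 * a)"
    unfolding c k by (simp add: power2_eq_square algebra_simps sq)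
  ultimately show ?thesis by (simp add: c_def w_def af)
qed

text \<open>Inversion swaps pi / sqrt 3 with its triple, so the cubic equation there reduces to k k'
  = 1/4 at pi sqrt 3. Together with k^2 + k'^2 = 1 and k < k' this gives k', and Landen's
  transformation does the last doubling.\<close>

lemma comodulus_12:
  "(comodulus (pi * sqrt 12))\<^sup>2 = 4 * (85 * sqrt 6 + 147 * sqrt 2 - 208 - 120 * sqrt 3)"
proof -
  define a b where "a = sqrt (2 :: real)" and "b = sqrt (3 :: real)"
  note ab = a_def b_def
  have q: "a\<^sup>2 = 2" "b\<^sup>2 = 3" and ab_pos: "a > 0" "b > 0" by (simp_all add: ab)
  have sq: "a * a = 2" "a * (a * z) = 2 * z" "b * b = 3" "b * (b * z) = 3 * z" for z
    using q by (simp_all add: power2_eq_square flip: mult.assoc)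
  define r where "r = pi / sqrt 3"
  define x where "x = modulus (pi * sqrt 3)"
  define x' where "x' = comodulus (pi * sqrt 3)"
  have r: "r > 0" by (simp add: r_def)
  have s: "pi * sqrt 3 = 3 * r" by (simp add: r_def field_simps)
  have inv: "modulus r = x'" "comodulus r = x"
    using comodulus_inversion[of "1 / sqrt 3"] comodulus_inversion[of "sqrt 3"]
    by (simp_all add: r_def x_def x'_def)
  have x: "x > 0" "x' > 0"
    by (simp_all add: x_def x'_def modulus_pos comodulus_pos)
  have less: "x < x'"
    unfolding inv(1)[symmetric] x_def using r s by (intro modulus_strict_antimono) simp_all
  have "2 * sqrt (x * x') = 1"
    using modulus_cubic[OF r] by (simp add: inv x_def x'_def s mult.commute)
  then have "(2 * sqrt (x * x'))\<^sup>2 = 1" by simp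
  then have xx: "4 * (x * x') = 1" using x by (simp add: power_mult_distrib)
  have x1: "x\<^sup>2 + x'\<^sup>2 = 1" using modulus_comodulus[of "pi * sqrt 3"] by (simp add: x_def x'_def)
  have "(2 * (x' + x))\<^sup>2 = 4 * (x\<^sup>2 + x'\<^sup>2) + 2 * (4 * (x * x'))"
    "(2 * (x' - x))\<^sup>2 = 4 * (x\<^sup>2 + x'\<^sup>2) - 2 * (4 * (x * x'))"
    by (simp_all add: power2_eq_square algebra_simps)
  then have sqs: "(2 * (x' + x))\<^sup>2 = (a * b)\<^sup>2" "(2 * (x' - x))\<^sup>2 = a\<^sup>2"
    unfolding xx x1 by (simp_all add: power_mult_distrib q)
  from sqs(1)
  have "2 * (x' + x) = a * b"
    by (rule power2_eq_imp_eq) (use x less ab_pos in auto)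
  moreover from sqs(2) have "2 * (x' - x) = a"
    by (rule power2_eq_imp_eq) (use x less ab_pos in auto)
  ultimately have x': "x' = (a * b + a) / 4" by simp
  have "sqrt (4 * 3) = 2 * sqrt (3 :: real)" by (subst real_sqrt_mult) simp
  then have s12: "pi * sqrt 12 = 2 * (pi * sqrt 3)" by simp
  have "(comodulus (pi * sqrt 12))\<^sup>2 = 1 - ((1 - x') / (1 + x'))\<^sup>2"
    unfolding s12 by (simp add: comodulus_square modulus_double x'_def)
  also have "\<dots> = ((1 + x')\<^sup>2 - (1 - x')\<^sup>2) / (1 + x')\<^sup>2"
    using x by (simp add: power_divide diff_divide_distrib[of "(1 + x')\<^sup>2"])
  also have "(1 + x')\<^sup>2 - (1 - x')\<^sup>2 = 4 * x'" by (simp add: power2_eq_square algebra_simps)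
  also have "4 * x' / (1 + x')\<^sup>2 = 4 * (85 * (a * b) + 147 * a - 208 - 120 * b)"
  proof -
    \<comment> \<open>The closed form is verified by clearing the denominator instead of
      rationalising the quotient.\<close>
    have "(85 * (a * b) + 147 * a - 208 - 120 * b) * (4 + (a * b + a))\<^sup>2 = 4 * (a * b + a)"
      by (simp add: power2_eq_square algebra_simps sq)
    moreover have "1 + x' = (4 + (a * b + a)) / 4" by (simp add: x' add_divide_distrib)
    ultimately have "x' = (85 * (a * b) + 147 * a - 208 - 120 * b) * (1 + x')\<^sup>2"
      by (simp only: power_divide times_divide_eq_right) (simp add: x')
    then have eq: "4 * x' = 4 * (85 * (a * b) + 147 * a - 208 - 120 * b) * (1 + x')\<^sup>2"
      by (metis mult.assoc)
    have D: "(1 + x')\<^sup>2 \<noteq> 0" using x by simp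
    show ?thesis unfolding nonzero_divide_eq_eq[OF D] by (rule eq)
  qed
  finally show ?thesis by (simp add: sqrt_6 ab)
qed

text \<open>Here 3 (pi sqrt 2) is the argument and the modulus \<open>y\<close> at pi sqrt 2 is
  known, so the cubic equation becomes a quartic for A = sqrt (x y).\<close>

lemma comodulus_18:
  "(comodulus (pi * sqrt 18))\<^sup>2 = 2 * (2772 * sqrt 3 - 4801 + 3395 * sqrt 2 - 1960 * sqrt 6)"
proof -
  define a b where "a = sqrt (2 :: real)" and "b = sqrt (3 :: real)"
  note ab = a_def b_def
  have q: "a\<^sup>2 = 2" "b\<^sup>2 = 3" by (simp_all add: ab)
  have sq: "a * a = 2" "a * (a * z) = 2 * z" "b * b = 3" "b * (b * z) = 3 * z" for z
    using q by (simp_all add: power2_eq_square flip: mult.assoc)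
  define y where "y = modulus (pi * sqrt 2)"
  define x where "x = modulus (pi * sqrt 18)"
  define A where "A = sqrt (y * x)"
  define B where "B = sqrt (comodulus (pi * sqrt 2) * comodulus (pi * sqrt 18))"
  define e where "e = 3 - 2 * a"
  have "sqrt (9 * 2) = 3 * sqrt (2 :: real)" by (subst real_sqrt_mult) simp
  then have s: "pi * sqrt 18 = 3 * (pi * sqrt 2)" by simp
  have x: "x > 0" "y > 0" "x < y"
    using modulus_strict_antimono[of "pi * sqrt 2" "pi * sqrt 18"]
    by (simp_all add: x_def y_def modulus_pos)
  have y: "y = a - 1" by (simp add: y_def modulus_2 a_def)
  have AB: "A + B = 1"
    using modulus_cubic[of "pi * sqrt 2"] by (simp add: A_def B_def x_def y_def s)
  have A2: "A\<^sup>2 = y * x" and A0: "A > 0" using x by (simp_all add: A_def)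
  have "B ^ 4 = (B\<^sup>2)\<^sup>2" by simp
  also have "\<dots> = (comodulus (pi * sqrt 2))\<^sup>2 * (comodulus (pi * sqrt 18))\<^sup>2"
    using comodulus_pos[of "pi * sqrt 2"] comodulus_pos[of "pi * sqrt 18"] by (simp add: B_def power_mult_distrib)
  also have "\<dots> = (1 - y\<^sup>2) * (1 - x\<^sup>2)"
    by (simp add: comodulus_square x_def y_def)
  finally have B4: "B ^ 4 = (1 - y\<^sup>2) * (1 - x\<^sup>2)" .
  \<comment> \<open>The bound amounts to e > 1/9, which later excludes the larger root.\<close>
  have a_less: "a < 13 / 9"
    unfolding a_def by (rule real_less_lsqrt) (simp_all add: power2_eq_square)
  have e: "e\<^sup>2 = 6 * e - 1" "e > 0" "y\<^sup>2 = e"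
    using a_less by (simp_all add: e_def y power2_eq_square algebra_simps sq)
  have "1 - A = B" using AB by simp
  then have A4: "(1 - A) ^ 4 = (1 - e) * (1 - x\<^sup>2)" using B4 e(3) by simp
  have ex: "e * x\<^sup>2 = A ^ 4" using A2 e(3) by algebra
  have "e * (1 - A) ^ 4 = (1 - e) * (e - e * x\<^sup>2)" unfolding A4 by (simp add: algebra_simps)
  then have "e * (1 - A) ^ 4 = (1 - e) * (e - A ^ 4)" by (simp only: ex)
  \<comment> \<open>The quartic factors only because e^2 = 6 e - 1; the last summand is the defect
    and vanishes for this \<open>e\<close>.\<close>
  moreover have "e * (1 - A) ^ 4 - (1 - e) * (e - A ^ 4) = (A\<^sup>2 - 4 * e * A + e\<^sup>2) * (A\<^sup>2 + 1) + A\<^sup>2 * (6 * e - 1 - e\<^sup>2)"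
    by (simp add: eval_nat_numeral algebra_simps)
  ultimately have "(A\<^sup>2 - 4 * e * A + e\<^sup>2) * (A\<^sup>2 + 1) = 0" by (simp add: e(1))
  moreover have "A\<^sup>2 + 1 > 0" by (simp add: add_nonneg_pos)
  moreover have "A\<^sup>2 - 4 * e * A + e\<^sup>2 = (A - e * (2 - b)) * (A - e * (2 + b))"
    by (simp add: power2_eq_square algebra_simps sq)
  ultimately have "(A - e * (2 - b)) * (A - e * (2 + b)) = 0" by simp
  \<comment> \<open>For this root A > 3 e, whereas x < y gives A^2 < y^2 = e; together 9 e <
    1.\<close>
  moreover have "A \<noteq> e * (2 + b)"
  proof
    assume "A = e * (2 + b)"
    moreover have "e * (2 + b) > e * 3"
      using e(2) real_sqrt_less_mono[of 1 3] by (intro mult_strict_left_mono) (auto simp: b_def)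
    ultimately have "A\<^sup>2 > (e * 3)\<^sup>2" using e(2) by (intro power_strict_mono) auto
    moreover have "y * x < y * y" using x by (intro mult_strict_left_mono) auto
    then have "A\<^sup>2 < e" unfolding A2 e(3)[symmetric] by (simp only: power2_eq_square)
    ultimately have "e * (9 * e) < e * 1" by (simp add: power2_eq_square)
    then have "9 * e < 1" using e(2) by simp
    then show False using a_less by (simp add: e_def)
  qed
  ultimately have A: "A = e * (2 - b)" by simp
  have "x\<^sup>2 = e ^ 3 * (2 - b) ^ 4"
  proof -
    have "e * x\<^sup>2 = e * (e ^ 3 * (2 - b) ^ 4)"
      unfolding ex A by (simp add: eval_nat_numeral)
    then show ?thesis using e(2) by simp
  qed
  then have "1 - x\<^sup>2 = 2 * (2772 * b - 4801 + 3395 * a - 1960 * (a * b))"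
    unfolding e_def by (simp add: eval_nat_numeral algebra_simps sq)
  then show ?thesis by (simp add: comodulus_square sqrt_6 x_def ab)
qed

theorem theorem6p4:
  shows "h' 2 1 = 2 powr (-1/8) * (sqrt 2 - 1) powr (1/8)
    \<and> h' 2 3 = 2 powr (-1/8) * (- 17 - 12 * sqrt 2 + 10 * sqrt 3 + 7 * sqrt 6) powr (1/8)
    \<and> h' 2 5 = 2 powr (-1/8) *
           (- 161 - 72 * sqrt 5 + 51 * sqrt 10 + 114 * sqrt 2) powr (1/8)
    \<and> h' 2 6 = (85 * sqrt 6 + 147 * sqrt 2 - 208 - 120 * sqrt 3) powr (1/8)
    \<and> h' 2 9 = 2 powr (-1/8) *
           (2772 * sqrt 3 - 4801 + 3395 * sqrt 2 - 1960 * sqrt 6) powr (1/8)"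
proof (intro conjI h'_2_eqI)
  \<comment> \<open>For n = 6 the factor 4 cancels the denominator of \<open>h'_2_eq\<close>, hence
    no power of 2 in front.\<close>
  have "(comodulus (pi * sqrt (2 * 6)))\<^sup>2 / 4 = 85 * sqrt 6 + 147 * sqrt 2 - 208 - 120 * sqrt 3"
    using comodulus_12 by simp
  then show "h' 2 6 = (85 * sqrt 6 + 147 * sqrt 2 - 208 - 120 * sqrt 3) powr (1/8)"
    using h'_2_eq[of 6] by (simp only: zero_less_numeral)
qed (simp_all add: comodulus_2 comodulus_6 comodulus_10 comodulus_18)

end
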